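(* Let $n\ge3$. Then there exists an uncountable set $\mathcal{G}$ of infinitely presented $n$-chain groups with simple commutator subgroups such that $G'\not\cong H'$ for all distinct $G,H\in\mathcal{G}$, where $G'$ and $H'$ denote the commutator subgroups.
   Context: A group is infinitely presented if it is not finitely presentable. $\mathrm{Homeo}^+(\mathbb{R})$ is the group of orientation preserving homeomorphisms of $\mathbb{R}$; $\operatorname{supp} f=\{x: f(x)\ne x\}$. For an interval $J$, $\partial^-J$ is its left endpoint. Chain of intervals: a collection $\{J_1,\ldots,J_n\}$ of nonempty open subintervals of $\mathbb{R}$ (possibly unbounded) such that $J_i\cap J_k=\varnothing$ if $|i-k|>1$, and $J_i\cap J_{i+1}$ is a proper nonempty subinterval of both $J_i$ and $J_{i+1}$ for $1\le i\le n-1$. $n$-chain group ($n\ge 2$): a group $\langle f_1,\ldots,f_n\rangle\le\mathrm{Homeo}^+(\mathbb{R})$ where $\{\operatorname{supp} f_1,\dots,\operatorname{supp} f_n\}$ is a chain of intervals with $\partial^-\operatorname{supp} f_i<\partial^-\operatorname{supp} f_{i+1}$ for all $i<n$, $f_i(t)\ge t$ for all $t$ and $i$, and $\langle f_i,f_{i+1}\rangle\cong F$ for each $1\le i\le n-1$. Here $F=\langle \{g_i\}_{i\ge0}\mid g_i^{-1}g_jg_i=g_{j+1}\text{ for }0\le i<j\rangle$ is Thompson's group. *)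

theory Defs
  imports "HOL-Analysis.Analysis" "HOL-Algebra.Generated_Groups" "HOL-Algebra.Elementary_Groups"
begin

section \<open>Group presentations\<close>

text \<open>
  A word is a list of letters; the letter \<open>(x, True)\<close> stands for the generator \<open>x\<close> and
  \<open>(x, False)\<close> for its formal inverse.
\<close>

type_synonym 'x word = "('x \<times> bool) list"

definition words :: "'x set \<Rightarrow> 'x word set" where
  "words S = lists (S \<times> UNIV)"

text \<open>
  Two words over \<open>S\<close> are related iff they represent the same element of the group
  \<open>\<langle>S | R\<rangle>\<close>, i.e. iff each can be turned into the other by finitely many insertions and deletions
  of subwords of the form \<open>x x\<^sup>-\<^sup>1\<close>, \<open>x\<^sup>-\<^sup>1 x\<close>, or \<open>r \<in> R\<close>.
\<close>

inductive pres_eq :: "'x set \<Rightarrow> 'x word set \<Rightarrow> 'x word \<Rightarrow> 'x word \<Rightarrow> bool"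
  for S :: "'x set" and R :: "'x word set" where
  refl: "w \<in> words S \<Longrightarrow> pres_eq S R w w"
| sym: "pres_eq S R u v \<Longrightarrow> pres_eq S R v u"
| trans: "pres_eq S R u v \<Longrightarrow> pres_eq S R v w \<Longrightarrow> pres_eq S R u w"
| cancel: "u \<in> words S \<Longrightarrow> v \<in> words S \<Longrightarrow> x \<in> S \<Longrightarrow>
             pres_eq S R (u @ [(x, b), (x, \<not> b)] @ v) (u @ v)"
| relator: "u \<in> words S \<Longrightarrow> v \<in> words S \<Longrightarrow> r \<in> R \<Longrightarrow> r \<in> words S \<Longrightarrow>
             pres_eq S R (u @ r @ v) (u @ v)"

definition presented_group :: "'x set \<Rightarrow> 'x word set \<Rightarrow> 'x word set monoid" where
  "presented_group S R =
     \<lparr>carrier = words S // {(u, v). pres_eq S R u v},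
      mult = (\<lambda>A B. {w. \<exists>a\<in>A. \<exists>b\<in>B. pres_eq S R (a @ b) w}),
      one = {w. pres_eq S R [] w}\<rparr>"

text \<open>Generators may be taken in \<open>nat\<close> without loss of generality, since \<open>S\<close> is finite.\<close>

definition finitely_presentable :: "('a, 'b) monoid_scheme \<Rightarrow> bool" where
  "finitely_presentable G \<longleftrightarrow>
     (\<exists>(S :: nat set) R. finite S \<and> finite R \<and> R \<subseteq> words S \<and> G \<cong> presented_group S R)"

definition infinitely_presented :: "('a, 'b) monoid_scheme \<Rightarrow> bool" where
  "infinitely_presented G \<longleftrightarrow> \<not> finitely_presentable G"

text \<open>The relation \<open>g\<^sub>i\<^sup>-\<^sup>1 g\<^sub>j g\<^sub>i = g\<^sub>j\<^sub>+\<^sub>1\<close> is encoded by the relator \<open>g\<^sub>i\<^sup>-\<^sup>1 g\<^sub>j g\<^sub>i g\<^sub>j\<^sub>+\<^sub>1\<^sup>-\<^sup>1\<close>.\<close>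

definition thompson_F :: "nat word set monoid" where
  "thompson_F = presented_group UNIV
     {[(i, False), (j, True), (i, True), (Suc j, False)] | i j. i < j}"

section \<open>Commutator subgroups and simplicity\<close>

definition commutator_subgroup :: "('a, 'b) monoid_scheme \<Rightarrow> ('a, 'b) monoid_scheme" where
  "commutator_subgroup G = G\<lparr>carrier := derived G (carrier G)\<rparr>"

text \<open>
  The locale \<open>simple_group\<close> of HOL-Algebra demands \<open>order G > 1\<close>, which excludes all infinite
  groups because the order of an infinite group is \<open>0\<close>; so it cannot be used here.
\<close>

definition is_simple :: "('a, 'b) monoid_scheme \<Rightarrow> bool" where
  "is_simple G \<longleftrightarrow> group G \<and> carrier G \<noteq> {\<one>\<^bsub>G\<^esub>} \<and>
     (\<forall>N. N \<lhd> G \<longrightarrow> N = carrier G \<or> N = {\<one>\<^bsub>G\<^esub>})"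

section \<open>Chain groups\<close>

text \<open>Orientation preserving homeomorphisms of the real line, under composition.\<close>

definition Homeo_plus :: "(real \<Rightarrow> real) monoid" where
  "Homeo_plus =
     \<lparr>carrier = {f. (\<exists>g. homeomorphism UNIV UNIV f g) \<and> strict_mono f},
      mult = (\<circ>), one = id\<rparr>"

definition supp :: "(real \<Rightarrow> real) \<Rightarrow> real set" where
  "supp f = {x. f x \<noteq> x}"

text \<open>The left endpoint is an extended real, since intervals may be unbounded.\<close>

definition left_endpoint :: "real set \<Rightarrow> ereal" where
  "left_endpoint J = (INF x\<in>J. ereal x)"

text \<open>The intervals of a chain are indexed by \<open>1, \<dots>, n\<close>.\<close>

definition chain_of_intervals :: "nat \<Rightarrow> (nat \<Rightarrow> real set) \<Rightarrow> bool" where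
  "chain_of_intervals n J \<longleftrightarrow>
     (\<forall>i\<in>{1..n}. J i \<noteq> {} \<and> open (J i) \<and> is_interval (J i)) \<and>
     (\<forall>i\<in>{1..n}. \<forall>k\<in>{1..n}. \<bar>int i - int k\<bar> > 1 \<longrightarrow> J i \<inter> J k = {}) \<and>
     (\<forall>i\<in>{1..<n}. is_interval (J i \<inter> J (Suc i)) \<and> J i \<inter> J (Suc i) \<noteq> {} \<and>
        J i \<inter> J (Suc i) \<subset> J i \<and> J i \<inter> J (Suc i) \<subset> J (Suc i))"

definition chain_group :: "nat \<Rightarrow> (real \<Rightarrow> real) monoid \<Rightarrow> bool" where
  "chain_group n G \<longleftrightarrow> n \<ge> 2 \<and>
     (\<exists>f :: nat \<Rightarrow> real \<Rightarrow> real.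
        (\<forall>i\<in>{1..n}. f i \<in> carrier Homeo_plus) \<and>
        chain_of_intervals n (\<lambda>i. supp (f i)) \<and>
        (\<forall>i\<in>{1..<n}. left_endpoint (supp (f i)) < left_endpoint (supp (f (Suc i)))) \<and>
        (\<forall>i\<in>{1..n}. \<forall>t. f i t \<ge> t) \<and>
        (\<forall>i\<in>{1..<n}. subgroup_generated Homeo_plus {f i, f (Suc i)} \<cong> thompson_F) \<and>
        G = subgroup_generated Homeo_plus (f ` {1..n}))"

section \<open>The structures above are groups\<close>

lemma pres_eq_words: "pres_eq S R u v \<Longrightarrow> u \<in> words S \<and> v \<in> words S"
  by (induction rule: pres_eq.induct) (auto simp: words_def)

lemma pres_eq_append:
  assumes "pres_eq S R u v" "p \<in> words S" "q \<in> words S"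
  shows "pres_eq S R (p @ u @ q) (p @ v @ q)"
  using assms
proof (induction rule: pres_eq.induct)
  case (refl w)
  then show ?case by (auto simp: words_def intro: pres_eq.refl)
next
  case (cancel u v x b)
  then show ?case using pres_eq.cancel[of "p @ u" S "v @ q" x R b] by (auto simp: words_def)
next
  case (relator u v r)
  then show ?case using pres_eq.relator[of "p @ u" S "v @ q" r R] by (auto simp: words_def)
qed (blast intro: pres_eq.sym pres_eq.trans)+

lemma pres_eq_mult:
  assumes "pres_eq S R u u'" "pres_eq S R v v'"
  shows "pres_eq S R (u @ v) (u' @ v')"
  using pres_eq_append[OF assms(1), of "[]" v] pres_eq_append[OF assms(2), of u' "[]"]
    pres_eq_words[OF assms(1)] pres_eq_words[OF assms(2)]
  by (auto simp: words_def intro: pres_eq.trans)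

abbreviation (input) pres_class :: "'x set \<Rightarrow> 'x word set \<Rightarrow> 'x word \<Rightarrow> 'x word set" where
  "pres_class S R u \<equiv> {w. pres_eq S R u w}"

lemma carrier_presented_group: "carrier (presented_group S R) = pres_class S R ` words S"
  by (auto simp: presented_group_def quotient_def)

lemma mult_presented_group:
  assumes "u \<in> words S" "v \<in> words S"
  shows "pres_class S R u \<otimes>\<^bsub>presented_group S R\<^esub> pres_class S R v = pres_class S R (u @ v)"
  using assms by (auto simp: presented_group_def intro: pres_eq.refl pres_eq_mult pres_eq.trans)

lemma pres_eq_inverse:
  assumes "w \<in> words S"
  shows "pres_eq S R (rev (map (\<lambda>(x, b). (x, \<not> b)) w) @ w) []"
  using assms
proof (induction w)
  case Nil
  then show ?case by (auto simp: words_def intro: pres_eq.refl)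
next
  case (Cons a w)
  obtain x b where a: "a = (x, b)" by force
  let ?v = "rev (map (\<lambda>(x, b). (x, \<not> b)) w)"
  have w: "w \<in> words S" "x \<in> S" using Cons.prems by (auto simp: words_def a)
  then have "?v \<in> words S" by (force simp: words_def in_lists_conv_set)
  then have "pres_eq S R (?v @ [(x, \<not> b), (x, \<not> \<not> b)] @ w) (?v @ w)"
    using w by (intro pres_eq.cancel)
  then show ?case using Cons.IH[OF w(1)] by (auto simp: a intro: pres_eq.trans)
qed

lemma group_presented_group: "group (presented_group S R)"
proof (rule groupI)
  have one: "\<one>\<^bsub>presented_group S R\<^esub> = pres_class S R []" by (simp add: presented_group_def)
  have Nil: "[] \<in> words S" by (simp add: words_def)
  have app: "u @ v \<in> words S" if "u \<in> words S" "v \<in> words S" for u v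
    using that by (simp add: words_def)
  show "\<one>\<^bsub>presented_group S R\<^esub> \<in> carrier (presented_group S R)"
    using Nil by (auto simp: one carrier_presented_group)
  fix A assume A: "A \<in> carrier (presented_group S R)"
  then obtain u where u: "u \<in> words S" "A = pres_class S R u"
    by (auto simp: carrier_presented_group)
  show "\<one>\<^bsub>presented_group S R\<^esub> \<otimes>\<^bsub>presented_group S R\<^esub> A = A"
    using mult_presented_group[OF Nil u(1), of R] by (simp add: one u)
  let ?v = "rev (map (\<lambda>(x, b). (x, \<not> b)) u)"
  have v: "?v \<in> words S" using u(1) by (force simp: words_def in_lists_conv_set)
  have "pres_class S R (?v @ u) = pres_class S R []"
    using pres_eq_inverse[OF u(1), of R] by (auto intro: pres_eq.sym pres_eq.trans)
  then show "\<exists>B\<in>carrier (presented_group S R).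
      B \<otimes>\<^bsub>presented_group S R\<^esub> A = \<one>\<^bsub>presented_group S R\<^esub>"
    using mult_presented_group[OF v u(1), of R] v
    by (intro bexI[of _ "pres_class S R ?v"]) (auto simp: one u carrier_presented_group)
  fix B assume "B \<in> carrier (presented_group S R)"
  then obtain v where v: "v \<in> words S" "B = pres_class S R v"
    by (auto simp: carrier_presented_group)
  show "A \<otimes>\<^bsub>presented_group S R\<^esub> B \<in> carrier (presented_group S R)"
    using u v app by (simp add: mult_presented_group) (auto simp: carrier_presented_group)
  fix C assume "C \<in> carrier (presented_group S R)"
  then obtain w where w: "w \<in> words S" "C = pres_class S R w"
    by (auto simp: carrier_presented_group)
  show "A \<otimes>\<^bsub>presented_group S R\<^esub> B \<otimes>\<^bsub>presented_group S R\<^esub> C =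
        A \<otimes>\<^bsub>presented_group S R\<^esub> (B \<otimes>\<^bsub>presented_group S R\<^esub> C)"
    using u v w app by (simp add: mult_presented_group)
qed

lemma group_Homeo_plus: "group Homeo_plus"
proof (rule groupI)
  fix f assume "f \<in> carrier Homeo_plus"
  then obtain g where g: "homeomorphism UNIV UNIV f g" and f: "strict_mono f"
    by (auto simp: Homeo_plus_def)
  have fg: "f (g x) = x" "g (f x) = x" for x
    using g by (auto simp: homeomorphism_def)
  have "strict_mono g"
    using f by (metis fg(1) strict_mono_def strict_mono_less)
  moreover have "homeomorphism UNIV UNIV g f"
    using g by (rule homeomorphism_symD)
  ultimately show "\<exists>g\<in>carrier Homeo_plus. g \<otimes>\<^bsub>Homeo_plus\<^esub> f = \<one>\<^bsub>Homeo_plus\<^esub>"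
    by (intro bexI[of _ g]) (auto simp: Homeo_plus_def fg)
next
  show "\<one>\<^bsub>Homeo_plus\<^esub> \<in> carrier Homeo_plus"
    by (auto simp: Homeo_plus_def strict_mono_def homeomorphism_def intro!: exI[of _ id])
next
  fix f g assume "f \<in> carrier Homeo_plus" "g \<in> carrier Homeo_plus"
  then show "f \<otimes>\<^bsub>Homeo_plus\<^esub> g \<in> carrier Homeo_plus"
    by (auto simp: Homeo_plus_def strict_mono_def intro: homeomorphism_compose)
qed (auto simp: Homeo_plus_def)

end

(*
  All chains consist of piecewise linear bumps with the two slopes 2 and 1/2, whose supports grow
  geometrically. Two neighbours f, g satisfy g (f b) = c, where b is the left endpoint of supp g and
  c the right endpoint of supp f; hence (g f)^-1, g^-1 and the conjugates of g^-1 by powers of g f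
  satisfy the relations of F, and normal forms together with the dynamics at the left endpoints of
  the supports show that no further relations hold. Since the orbit of b is dense, every compact
  subinterval can be contracted into every open one, and Higman's argument gives simplicity of the
  commutator subgroup.

  Only the first bump depends on the parameter a. The right endpoint c of its support lies inside
  the supports of the second and third bumps, whose dense orbits are independent of a, and
  commutation relations between elements of the commutator subgroup detect on which side of an
  orbit point c lies. So an isomorphism of commutator subgroups preserving a certain triple of
  elements preserves a. As commutator subgroups are countable, each isomorphism type occurs for
  only countably many a; and there are only countably many finite presentations.
*)

theory Submission
  imports Defs
begin

section \<open>Groups satisfying the relations of Thompson's group\<close>

text \<open>The slopes are chosen so that the pieces fit. A bump starting at a and breaking at b has
  right endpoint c = 3 b - 2 a, and doubling b about a and then about b gives 2 (2 b - a) - b, which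
  is c again. The same doublings are the expanding maps behind the density of the orbit of b. For
  the first bump b = 4 and c = 12 - 2 a, so 2 < a < 4 lets c run through (4, 8).

  The obstacle is that an isomorphism of commutator subgroups is given abstractly and says nothing
  about points of the line. No reconstruction of the action from the group is attempted; the three
  marked elements replace it. They must lie in the commutator subgroup, whose elements are trivial
  near both ends, so bumps are replaced by commutators, or by elements that agree with a bump on a
  large interval. No individual parameter is shown to give an infinitely presented group: counting
  shows that all but countably many do.\<close>

definition eval_word :: "('a, 'b) monoid_scheme \<Rightarrow> ('x \<Rightarrow> 'a) \<Rightarrow> 'x word \<Rightarrow> 'a" where
  "eval_word H y w =
     foldr (\<lambda>(s, b) z. (if b then y s else inv\<^bsub>H\<^esub> y s) \<otimes>\<^bsub>H\<^esub> z) w \<one>\<^bsub>H\<^esub>"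

lemma eval_word_Nil [simp]: "eval_word H y [] = \<one>\<^bsub>H\<^esub>"
  by (simp add: eval_word_def)

lemma eval_word_Cons [simp]:
  "eval_word H y ((s, b) # w) = (if b then y s else inv\<^bsub>H\<^esub> y s) \<otimes>\<^bsub>H\<^esub> eval_word H y w"
  by (simp add: eval_word_def)

lemma words_Nil [simp]: "[] \<in> words S"
  by (simp add: words_def)

lemma words_Cons [simp]: "(s, b) # w \<in> words S \<longleftrightarrow> s \<in> S \<and> w \<in> words S"
  by (auto simp: words_def)

lemma words_append [simp]: "u @ v \<in> words S \<longleftrightarrow> u \<in> words S \<and> v \<in> words S"
  by (auto simp: words_def)

context group
begin

lemma eval_word_closed [simp]:
  assumes "\<And>s. s \<in> S \<Longrightarrow> y s \<in> carrier G" "w \<in> words S"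
  shows "eval_word G y w \<in> carrier G"
  using assms(2)
proof (induction w)
  case (Cons a w)
  then show ?case using assms(1) by (cases a) auto
qed simp

lemma eval_word_append:
  assumes "\<And>s. s \<in> S \<Longrightarrow> y s \<in> carrier G" "u \<in> words S" "v \<in> words S"
  shows "eval_word G y (u @ v) = eval_word G y u \<otimes> eval_word G y v"
  using assms(2)
proof (induction u)
  case Nil
  then show ?case using eval_word_closed[OF assms(1,3)] by simp
next
  case (Cons a w)
  then show ?case using eval_word_closed[of S y w, OF assms(1)] eval_word_closed[OF assms(1,3)] assms(1)
    by (cases a) (auto simp: m_assoc)
qed

lemma eval_word_pres_eq:
  assumes y: "\<And>s. s \<in> S \<Longrightarrow> y s \<in> carrier G"
    and R: "\<And>r. r \<in> R \<Longrightarrow> r \<in> words S \<Longrightarrow> eval_word G y r = \<one>"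
    and "pres_eq S R u v"
  shows "eval_word G y u = eval_word G y v"
  using assms(3)
proof (induction rule: pres_eq.induct)
  case (cancel u v x b)
  have "eval_word G y ((x, b) # (x, \<not> b) # v) = eval_word G y v"
    using cancel y eval_word_closed[where S = S, OF y cancel(2)] by (simp flip: m_assoc)
  then show ?case
    using cancel eval_word_append[where S = S, OF y] by simp
next
  case (relator u v r)
  have "eval_word G y (r @ v) = eval_word G y v"
    using relator eval_word_closed[where S = S, OF y relator(2)] R
      by (simp add: eval_word_append[where S = S, OF y])
  then show ?case
    using relator eval_word_append[where S = S, OF y] by simp
qed auto

text \<open>Von Dyck's theorem. A class is evaluated at a chosen representative, which is harmless
  because evaluation respects \<open>pres_eq\<close>.\<close>

lemma presented_group_hom:
  assumes y: "\<And>s. s \<in> S \<Longrightarrow> y s \<in> carrier G"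
    and R: "\<And>r. r \<in> R \<Longrightarrow> r \<in> words S \<Longrightarrow> eval_word G y r = \<one>"
  shows "\<exists>\<phi>\<in>hom (presented_group S R) G. \<forall>s\<in>S. \<phi> (pres_class S R [(s, True)]) = y s"
proof -
  define \<phi> where "\<phi> A = eval_word G y (SOME w. w \<in> A)" for A
  have \<phi>: "\<phi> (pres_class S R u) = eval_word G y u" if "u \<in> words S" for u
  proof -
    have "pres_eq S R u (SOME w. w \<in> pres_class S R u)"
      using someI[of "\<lambda>w. w \<in> pres_class S R u" u] that by (auto intro: pres_eq.refl)
    then show ?thesis
      unfolding \<phi>_def using eval_word_pres_eq[OF y R] by metis
  qed
  have "\<phi> \<in> hom (presented_group S R) G"
  proof (rule homI)
    fix A assume "A \<in> carrier (presented_group S R)"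
    then show "\<phi> A \<in> carrier G"
      using eval_word_closed[OF y] by (auto simp: carrier_presented_group \<phi>)
  next
    fix A B assume "A \<in> carrier (presented_group S R)" "B \<in> carrier (presented_group S R)"
    then obtain u v where "u \<in> words S" "v \<in> words S" "A = pres_class S R u" "B = pres_class S R v"
      by (auto simp: carrier_presented_group)
    then show "\<phi> (A \<otimes>\<^bsub>presented_group S R\<^esub> B) = \<phi> A \<otimes> \<phi> B"
      using eval_word_append[OF y] by (simp add: mult_presented_group \<phi>)
  qed
  then show ?thesis
    using y by (intro bexI[of _ \<phi>]) (auto simp: \<phi>)
qed

end

lemma generate_presented_group:
  "generate (presented_group S R) ((\<lambda>s. pres_class S R [(s, True)]) ` S)
     = carrier (presented_group S R)" (is "generate ?F ?X = _")
proof
  interpret group ?F by (rule group_presented_group)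
  show "generate ?F ?X \<subseteq> carrier ?F"
    by (rule generate_incl) (auto simp: carrier_presented_group)
  have one: "pres_class S R [] = \<one>\<^bsub>?F\<^esub>"
    by (simp add: presented_group_def)
  have letter: "pres_class S R [(s, b)] \<in> generate ?F ?X" if "s \<in> S" for s b
  proof (cases b)
    case True
    then show ?thesis using that by (auto intro: generate.incl)
  next
    case False
    have "pres_class S R [(s, False)] \<otimes>\<^bsub>?F\<^esub> pres_class S R [(s, True)] = pres_class S R []"
      using that pres_eq.cancel[of "[]" S "[]" s R False]
      by (auto simp: mult_presented_group intro: pres_eq.trans pres_eq.sym)
    then have "inv\<^bsub>?F\<^esub> (pres_class S R [(s, True)]) = pres_class S R [(s, False)]"
      using that by (intro inv_equality) (auto simp: one carrier_presented_group)
    then show ?thesis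
      using that False generate.inv[of "pres_class S R [(s, True)]" ?X ?F] by auto
  qed
  have "pres_class S R w \<in> generate ?F ?X" if "w \<in> words S" for w
    using that
  proof (induction w)
    case Nil
    then show ?case by (simp add: one generate.one)
  next
    case (Cons a w)
    obtain s b where a: "a = (s, b)" by force
    have "pres_class S R (a # w) = pres_class S R [a] \<otimes>\<^bsub>?F\<^esub> pres_class S R w"
      using Cons.prems mult_presented_group[of "[a]" S w R] by (simp add: a)
    then show ?case
      using Cons letter[of s b] by (simp add: a generate.eng)
  qed
  then show "carrier ?F \<subseteq> generate ?F ?X"
    by (auto simp: carrier_presented_group)
qed

section \<open>Positive words and fractions\<close>

locale thompson_relations = group +
  fixes x :: "nat \<Rightarrow> 'a"
  assumes x_closed [simp]: "x i \<in> carrier G"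
    and x_rel: "i < j \<Longrightarrow> inv (x i) \<otimes> x j \<otimes> x i = x (Suc j)"
begin

definition pos :: "nat list \<Rightarrow> 'a" where
  "pos P = foldr (\<lambda>i z. x i \<otimes> z) P \<one>"

lemma pos_Nil [simp]: "pos [] = \<one>"
  and pos_Cons [simp]: "pos (i # P) = x i \<otimes> pos P"
  by (simp_all add: pos_def)

lemma pos_closed [simp]: "pos P \<in> carrier G"
  by (induction P) auto

lemma pos_append: "pos (P @ Q) = pos P \<otimes> pos Q"
  by (induction P) (auto simp: m_assoc)

lemma x_swap: "i < j \<Longrightarrow> x j \<otimes> x i = x i \<otimes> x (Suc j)"
  by (simp add: x_rel[symmetric]) (simp flip: m_assoc)

lemma inv_x_swap: "i < j \<Longrightarrow> inv (x i) \<otimes> x j = x (Suc j) \<otimes> inv (x i)"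
  using x_rel[of i j] by (metis inv_closed inv_solve_right m_closed x_closed)

lemma inv_x_swap': "j < i \<Longrightarrow> inv (x i) \<otimes> x j = x j \<otimes> inv (x (Suc i))"
  using x_swap[of j i] by (metis inv_closed inv_solve_left inv_solve_right m_assoc m_closed x_closed)

text \<open>The inverse letter travels to the right through \<open>P\<close>: it raises each larger
  letter by one, is itself raised by each smaller letter, and cancels against its own letter. Since
  the travelling index changes, the induction is for all \<open>i\<close>.\<close>

lemma inv_x_pos: "\<exists>P' Q. inv (x i) \<otimes> pos P = pos P' \<otimes> inv (pos Q)"
proof (induction P arbitrary: i)
  case Nil
  show ?case by (intro exI[of _ "[]"] exI[of _ "[i]"]) simp
next
  case (Cons j P)
  consider "i = j" | "i < j" | "j < i" by linarith
  then show ?case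
  proof cases
    case 1
    have "inv (x i) \<otimes> pos (j # P) = pos P"
      using 1 by (simp flip: m_assoc)
    then show ?thesis by (intro exI[of _ P] exI[of _ "[]"]) simp
  next
    case 2
    obtain P' Q where IH: "inv (x i) \<otimes> pos P = pos P' \<otimes> inv (pos Q)"
      using Cons.IH by blast
    have "inv (x i) \<otimes> pos (j # P) = x (Suc j) \<otimes> (inv (x i) \<otimes> pos P)"
      using inv_x_swap[OF 2] by (simp flip: m_assoc)
    then show ?thesis
      by (intro exI[of _ "Suc j # P'"] exI[of _ Q]) (simp add: IH m_assoc)
  next
    case 3
    obtain P' Q where IH: "inv (x (Suc i)) \<otimes> pos P = pos P' \<otimes> inv (pos Q)"
      using Cons.IH by blast
    have "inv (x i) \<otimes> pos (j # P) = x j \<otimes> (inv (x (Suc i)) \<otimes> pos P)"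
      using inv_x_swap'[OF 3] by (simp flip: m_assoc)
    then show ?thesis
      by (intro exI[of _ "j # P'"] exI[of _ Q]) (simp add: IH m_assoc)
  qed
qed

lemma inv_pos_pos: "\<exists>P' Q'. inv (pos Q) \<otimes> pos P = pos P' \<otimes> inv (pos Q')"
proof (induction Q arbitrary: P)
  case Nil
  show ?case by (intro exI[of _ P] exI[of _ "[]"]) simp
next
  case (Cons i Q)
  obtain P1 Q1 where 1: "inv (x i) \<otimes> pos P = pos P1 \<otimes> inv (pos Q1)"
    using inv_x_pos by blast
  obtain P2 Q2 where 2: "inv (pos Q) \<otimes> pos P1 = pos P2 \<otimes> inv (pos Q2)"
    using Cons.IH by blast
  have "inv (pos (i # Q)) \<otimes> pos P = inv (pos Q) \<otimes> pos P1 \<otimes> inv (pos Q1)"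
    by (simp add: inv_mult_group m_assoc 1)
  also have "\<dots> = pos P2 \<otimes> inv (pos (Q1 @ Q2))"
    by (simp add: 2 pos_append inv_mult_group m_assoc)
  finally show ?case by blast
qed

text \<open>In a product of two fractions, \<open>inv_pos_pos\<close> turns the inner quotient into
  a fraction, and the outer words absorb its two parts.\<close>

lemma generate_eq_fraction:
  assumes "w \<in> generate G (range x)"
  shows "\<exists>P Q. w = pos P \<otimes> inv (pos Q)"
  using assms
proof (induction rule: generate.induct)
  case one
  show ?case by (intro exI[of _ "[]"]) simp
next
  case (incl h)
  then obtain i where "h = x i" by auto
  then show ?case by (intro exI[of _ "[i]"] exI[of _ "[]"]) simp
next
  case (inv h)
  then obtain i where "h = x i" by auto
  then show ?case by (intro exI[of _ "[]"] exI[of _ "[i]"]) simp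
next
  case (eng h1 h2)
  then obtain P Q P' Q' where h: "h1 = pos P \<otimes> inv (pos Q)" "h2 = pos P' \<otimes> inv (pos Q')"
    by blast
  obtain P1 Q1 where 1: "inv (pos Q) \<otimes> pos P' = pos P1 \<otimes> inv (pos Q1)"
    using inv_pos_pos by blast
  have "h1 \<otimes> h2 = pos P \<otimes> (inv (pos Q) \<otimes> pos P') \<otimes> inv (pos Q')"
    by (simp add: h m_assoc)
  also have "\<dots> = pos (P @ P1) \<otimes> inv (pos (Q' @ Q1))"
    by (simp add: 1 pos_append inv_mult_group m_assoc)
  finally show ?case by blast
qed

end

text \<open>Moving the first \<open>m\<close> to the front raises the larger letters before it by one.\<close>

fun pull :: "nat \<Rightarrow> nat list \<Rightarrow> nat list" where
  "pull m [] = []"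
| "pull m (j # P) = (if j = m then P else Suc j # pull m P)"

lemma length_pull: "m \<in> set P \<Longrightarrow> length (pull m P) < length P"
  by (induction P) auto

lemma (in thompson_relations) pos_pull:
  assumes "m \<in> set P" "\<forall>k\<in>set P. m \<le> k"
  shows "pos P = x m \<otimes> pos (pull m P)"
  using assms
proof (induction P)
  case (Cons j P)
  show ?case
  proof (cases "j = m")
    case False
    then have "pos P = x m \<otimes> pos (pull m P)" "m < j"
      using Cons by auto
    then have "pos (j # P) = x m \<otimes> x (Suc j) \<otimes> pos (pull m P)"
      by (simp add: x_swap flip: m_assoc)
    then show ?thesis using False by (simp add: m_assoc)
  qed simp
qed simp

text \<open>
  The least letter of the two words is pulled out of both and cancelled, repeatedly.
\<close>

lemma pos_eq_transfer:
  assumes "thompson_relations G x" "thompson_relations H y"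
    and sep: "\<And>P Q m. thompson_relations.pos H y P = thompson_relations.pos H y Q \<Longrightarrow> m \<in> set P \<Longrightarrow>
                \<forall>k\<in>set P \<union> set Q. m \<le> k \<Longrightarrow> m \<in> set Q"
    and "thompson_relations.pos H y P = thompson_relations.pos H y Q"
  shows "thompson_relations.pos G x P = thompson_relations.pos G x Q"
  using assms(4)
proof (induction "length P + length Q" arbitrary: P Q rule: less_induct)
  case less
  interpret G: thompson_relations G x by fact
  interpret H: thompson_relations H y by fact
  show ?case
  proof (cases "set P \<union> set Q = {}")
    case False
    define m where "m = Min (set P \<union> set Q)"
    have le: "\<forall>k\<in>set P \<union> set Q. m \<le> k" by (simp add: m_def)
    have "m \<in> set P \<union> set Q" unfolding m_def using False by (intro Min_in) auto
    \<comment> \<open>\<open>sep\<close> is applied in both directions, since \<open>m\<close> is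
      only known to occur in one of the words.\<close>
    then have m: "m \<in> set P" "m \<in> set Q"
      using sep[of P Q m] sep[of Q P m] less.prems le by auto
    have "y m \<otimes>\<^bsub>H\<^esub> H.pos (pull m P) = y m \<otimes>\<^bsub>H\<^esub> H.pos (pull m Q)"
      using H.pos_pull m le less.prems by auto
    then have "H.pos (pull m P) = H.pos (pull m Q)" by simp
    then have "G.pos (pull m P) = G.pos (pull m Q)"
      using length_pull[OF m(1)] length_pull[OF m(2)] by (intro less.hyps) auto
    then show ?thesis
      using G.pos_pull m le by auto
  qed simp
qed

section \<open>Comparison with Thompson's group\<close>

definition thompson_gen :: "nat \<Rightarrow> nat word set" where
  "thompson_gen i = pres_class UNIV
     {[(i, False), (j, True), (i, True), (Suc j, False)] | i j. i < j} [(i, True)]"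

lemma group_thompson_F: "group thompson_F"
  unfolding thompson_F_def by (rule group_presented_group)

lemma generate_thompson_F: "generate thompson_F (range thompson_gen) = carrier thompson_F"
  using generate_presented_group[of UNIV] by (simp add: thompson_F_def thompson_gen_def)

lemma thompson_relations_F: "thompson_relations thompson_F thompson_gen"
proof -
  interpret group thompson_F by (rule group_thompson_F)
  define R :: "nat word set"
    where "R = {[(i, False), (j, True), (i, True), (Suc j, False)] | i j. i < j}"
  have F: "thompson_F = presented_group UNIV R" "\<And>i. thompson_gen i = pres_class UNIV R [(i, True)]"
    by (simp_all add: thompson_F_def thompson_gen_def R_def)
  have closed: "pres_class UNIV R w \<in> carrier thompson_F" for w
    by (auto simp: F carrier_presented_group words_def)
  have eq: "pres_class UNIV R u = pres_class UNIV R v" if "pres_eq UNIV R u v" for u v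
    using that by (auto intro: pres_eq.trans pres_eq.sym)
  have mult: "pres_class UNIV R u \<otimes>\<^bsub>thompson_F\<^esub> pres_class UNIV R v = pres_class UNIV R (u @ v)" for u v
    by (simp add: F mult_presented_group words_def)
  have one: "pres_class UNIV R [] = \<one>\<^bsub>thompson_F\<^esub>"
    by (simp add: F presented_group_def)
  have inv: "inv\<^bsub>thompson_F\<^esub> thompson_gen i = pres_class UNIV R [(i, False)]" for i
  proof (rule inv_equality)
    show "pres_class UNIV R [(i, False)] \<otimes>\<^bsub>thompson_F\<^esub> thompson_gen i = \<one>\<^bsub>thompson_F\<^esub>"
      unfolding F(2) mult one[symmetric]
      using pres_eq.cancel[of "[]" UNIV "[]" i R False] by (intro eq) simp
  qed (auto simp: closed F(2))
  show ?thesis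
  proof
    show "thompson_gen i \<in> carrier thompson_F" for i
      by (simp add: closed F(2))
    fix i j :: nat assume "i < j"
    let ?r = "[(i, False), (j, True), (i, True), (Suc j, False)]"
    have "pres_eq UNIV R ([] @ ?r @ [(Suc j, True)]) ([] @ [(Suc j, True)])"
      using \<open>i < j\<close> by (intro pres_eq.relator) (auto simp: R_def)
    moreover have "pres_eq UNIV R ([(i, False), (j, True), (i, True)] @ [(Suc j, False), (Suc j, \<not> False)] @ [])
                     ([(i, False), (j, True), (i, True)] @ [])"
      by (intro pres_eq.cancel) auto
    ultimately have "pres_eq UNIV R [(i, False), (j, True), (i, True)] [(Suc j, True)]"
      by (auto intro: pres_eq.trans pres_eq.sym)
    then show "inv\<^bsub>thompson_F\<^esub> thompson_gen i \<otimes>\<^bsub>thompson_F\<^esub> thompson_gen j \<otimes>\<^bsub>thompson_F\<^esub> thompson_gen i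
        = thompson_gen (Suc j)"
      unfolding inv unfolding F(2) mult by (intro eq) simp
  qed
qed

text \<open>The canonical map from F hits the generators \<open>y i\<close>. An element of its
  kernel is a fraction of positive words with equal images, and \<open>pos_eq_transfer\<close> pulls
  this equality back to F.\<close>

lemma generated_iso_thompson_F:
  assumes "thompson_relations H y"
    and sep: "\<And>P Q m. thompson_relations.pos H y P = thompson_relations.pos H y Q \<Longrightarrow> m \<in> set P \<Longrightarrow>
                \<forall>k\<in>set P \<union> set Q. m \<le> k \<Longrightarrow> m \<in> set Q"
  shows "subgroup_generated H (range y) \<cong> thompson_F"
proof -
  interpret H: thompson_relations H y by fact
  interpret F: thompson_relations thompson_F thompson_gen by (rule thompson_relations_F)
  define R :: "nat word set"
    where "R = {[(i, False), (j, True), (i, True), (Suc j, False)] | i j. i < j}"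
  have "eval_word H y r = \<one>\<^bsub>H\<^esub>" if "r \<in> R" for r
    using that H.x_rel by (auto simp: R_def simp flip: H.m_assoc)
  then obtain \<phi> where hom: "\<phi> \<in> hom thompson_F H" and \<phi>: "\<And>i. \<phi> (thompson_gen i) = y i"
    using H.presented_group_hom[of UNIV y R] by (auto simp: thompson_F_def thompson_gen_def R_def)
  interpret \<phi>: group_hom thompson_F H \<phi>
    using hom by unfold_locales
  have "\<phi> (F.pos P) = H.pos P" for P
    by (induction P) (simp_all add: \<phi>)
  then have inj: "g = \<one>\<^bsub>thompson_F\<^esub>" if g: "g \<in> carrier thompson_F" "\<phi> g = \<one>\<^bsub>H\<^esub>" for g
  proof -
    obtain P Q where PQ: "g = F.pos P \<otimes>\<^bsub>thompson_F\<^esub> inv\<^bsub>thompson_F\<^esub> (F.pos Q)"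
      using F.generate_eq_fraction g(1) generate_thompson_F by blast
    then have "H.pos P \<otimes>\<^bsub>H\<^esub> inv\<^bsub>H\<^esub> (H.pos Q) = \<one>\<^bsub>H\<^esub>"
      using g(2) by (simp add: \<open>\<And>P. \<phi> (F.pos P) = H.pos P\<close>)
    then have "H.pos P = H.pos Q"
      using H.inv_solve_right[of "\<one>\<^bsub>H\<^esub>" "H.pos P" "H.pos Q"] by (simp add: H.inv_solve_right')
    then have "F.pos P = F.pos Q"
      using pos_eq_transfer[of thompson_F thompson_gen H y P Q] thompson_relations_F assms by blast
    then show ?thesis using PQ by simp
  qed
  have "\<phi> ` carrier thompson_F = generate H (range y)"
    using \<phi>.generate_img[of "range thompson_gen"]
    by (simp add: generate_thompson_F \<phi> image_image image_subset_iff)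
  then have "\<phi> \<in> iso thompson_F (subgroup_generated H (range y))"
    using inj hom \<phi>.inj_on_one_iff
    by (simp add: iso_def bij_betw_def carrier_subgroup_generated Int_absorb1 image_subset_iff
        hom_into_subgroup_eq_gen flip: \<open>\<phi> ` carrier thompson_F = generate H (range y)\<close>)
  then have "thompson_F \<cong> subgroup_generated H (range y)"
    by (auto simp: is_iso_def)
  then show ?thesis
    by (rule F.iso_sym)
qed

section \<open>Commutators\<close>

definition (in monoid) commutator :: "'a \<Rightarrow> 'a \<Rightarrow> 'a" where
  "commutator g h = g \<otimes> h \<otimes> inv g \<otimes> inv h"

context group
begin

lemma inv_mult_cancel [simp]:
  assumes "g \<in> carrier G" "h \<in> carrier G"
  shows "inv g \<otimes> (g \<otimes> h) = h" "g \<otimes> (inv g \<otimes> h) = h"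
  using assms by (simp_all flip: m_assoc)

lemma commutator_closed [simp]:
  "g \<in> carrier G \<Longrightarrow> h \<in> carrier G \<Longrightarrow> commutator g h \<in> carrier G"
  by (simp add: commutator_def)

lemma commutator_in_derived:
  "g \<in> H \<Longrightarrow> h \<in> H \<Longrightarrow> commutator g h \<in> derived G H"
  unfolding derived_def commutator_def by (rule generate.incl) blast

lemma inv_commutator:
  assumes "g \<in> carrier G" "h \<in> carrier G"
  shows "inv (commutator g h) = commutator h g"
  using assms by (simp add: commutator_def inv_mult_group m_assoc)

lemma commutator_eq_one_iff:
  assumes "g \<in> carrier G" "h \<in> carrier G"
  shows "commutator g h = \<one> \<longleftrightarrow> g \<otimes> h = h \<otimes> g"
proof -
  have "commutator g h = (g \<otimes> h) \<otimes> inv (h \<otimes> g)"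
    using assms by (simp add: commutator_def inv_mult_group m_assoc)
  then show ?thesis
    using assms inv_solve_right'[of "\<one>" "g \<otimes> h" "h \<otimes> g"] by auto
qed

lemma commutator_mult_left:
  assumes "g \<in> carrier G" "r \<in> carrier G" "h \<in> carrier G" "r \<otimes> h = h \<otimes> r"
  shows "commutator (g \<otimes> r) h = commutator g h"
proof -
  have "commutator (g \<otimes> r) h = g \<otimes> (r \<otimes> h) \<otimes> inv r \<otimes> inv g \<otimes> inv h"
    using assms(1-3) by (simp add: commutator_def inv_mult_group m_assoc)
  also have "\<dots> = commutator g h"
    using assms(1-3) unfolding assms(4) by (simp add: commutator_def m_assoc)
  finally show ?thesis .
qed

lemma commutator_mult_right:
  assumes "g \<in> carrier G" "r \<in> carrier G" "h \<in> carrier G" "r \<otimes> g = g \<otimes> r"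
  shows "commutator g (h \<otimes> r) = commutator g h"
  using commutator_mult_left[of h r g] assms inv_commutator[of "h \<otimes> r" g] inv_commutator[of h g]
  by simp

lemma conj_commutator:
  assumes "g \<in> carrier G" "h \<in> carrier G" "k \<in> carrier G"
  shows "commutator (k \<otimes> g \<otimes> inv k) (k \<otimes> h \<otimes> inv k) = k \<otimes> commutator g h \<otimes> inv k"
  using assms
  by (simp add: commutator_def inv_mult_group m_assoc)

text \<open>Modulo \<open>N\<close> the elements commuting with \<open>g\<close> form a subgroup:
  for inverses and products the new commutator is built from conjugates of the old ones.\<close>

lemma commutator_generate_normal:
  assumes "N \<lhd> G" and g: "g \<in> carrier G" and S: "S \<subseteq> carrier G"
    and comm: "\<And>s. s \<in> S \<Longrightarrow> commutator g s \<in> N" and h: "h \<in> generate G S"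
  shows "commutator g h \<in> N"
proof -
  interpret N: normal N G by fact
  have carr: "h \<in> carrier G" if "h \<in> generate G S" for h
    using generate_in_carrier S that by blast
  show ?thesis
    using h
  proof (induction rule: generate.induct)
    case one
    then show ?case using g by (simp add: commutator_def)
  next
    case (incl h)
    then show ?case by (rule comm)
  next
    case (inv h)
    then have "h \<in> carrier G" using S by auto
    then have "commutator g (inv h) = inv h \<otimes> inv (commutator g h) \<otimes> inv (inv h)"
      using g by (simp add: commutator_def inv_mult_group m_assoc)
    then show ?case
      using N.inv_op_closed2[of "inv h" "inv (commutator g h)"] comm[OF inv] \<open>h \<in> carrier G\<close> by simp
  next
    case (eng h k)
    have hk: "h \<in> carrier G" "k \<in> carrier G"
      using eng carr by auto
    then have "commutator g (h \<otimes> k) = commutator g h \<otimes> (h \<otimes> commutator g k \<otimes> inv h)"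
      using g by (simp add: commutator_def inv_mult_group m_assoc)
    then show ?case
      using N.inv_op_closed2[OF hk(1) eng(4)] eng(3) by simp
  qed
qed

text \<open>The quotient by \<open>N\<close> is abelian once the images of the generators commute.
  The commutator condition is extended from \<open>S\<close> to the whole group in one argument
  after the other.\<close>

lemma derived_generate_subset_normal:
  assumes "N \<lhd> G" "S \<subseteq> carrier G" "carrier G = generate G S"
    and comm: "\<And>s t. s \<in> S \<Longrightarrow> t \<in> S \<Longrightarrow> commutator s t \<in> N"
  shows "derived G (carrier G) \<subseteq> N"
proof -
  interpret N: normal N G by fact
  have 1: "commutator s h \<in> N" if "s \<in> S" "h \<in> carrier G" for s h
    using commutator_generate_normal[OF assms(1) _ assms(2) comm] that assms(2,3) by auto
  have 2: "commutator h s \<in> N" if "s \<in> S" "h \<in> carrier G" for s h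
    using N.m_inv_closed[OF 1[OF that]] inv_commutator[of s h] that assms(2) by (simp add: subset_iff)
  have "commutator g h \<in> N" if "g \<in> carrier G" "h \<in> carrier G" for g h
    using commutator_generate_normal[OF assms(1) that(1) assms(2) 2[OF _ that(1)]] that(2) assms(3) by auto
  then have "derived_set G (carrier G) \<subseteq> N"
    by (auto simp: commutator_def)
  then show ?thesis
    unfolding derived_def using N.subgroup_axioms by (rule generate_subgroup_incl)
qed

end

section \<open>Homeomorphisms of the line\<close>

lemma Homeo_plus_simps [simp]:
  "f \<otimes>\<^bsub>Homeo_plus\<^esub> g = f \<circ> g" "\<one>\<^bsub>Homeo_plus\<^esub> = id"
  by (simp_all add: Homeo_plus_def)

interpretation HP: group Homeo_plus
  by (rule group_Homeo_plus)

abbreviation homeo :: "(real \<Rightarrow> real) set" where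
  "homeo \<equiv> carrier Homeo_plus"

abbreviation hinv :: "(real \<Rightarrow> real) \<Rightarrow> real \<Rightarrow> real" where
  "hinv f \<equiv> inv\<^bsub>Homeo_plus\<^esub> f"

lemma homeo_comp: "f \<in> homeo \<Longrightarrow> g \<in> homeo \<Longrightarrow> f \<circ> g \<in> homeo"
  using HP.m_closed[of f g] by simp

lemma homeoI:
  assumes "continuous_on UNIV f" "continuous_on UNIV g" "strict_mono f"
    and "\<And>x. f (g x) = x" "\<And>x. g (f x) = x"
  shows "f \<in> homeo"
proof -
  have "range f = UNIV" "range g = UNIV"
    using assms(4,5) by (metis surjI)+
  then show ?thesis
    using assms by (auto simp: Homeo_plus_def homeomorphism_def intro!: exI[of _ g])
qed

lemma homeo_strict_mono: "f \<in> homeo \<Longrightarrow> strict_mono f"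
  by (auto simp: Homeo_plus_def)

lemma homeo_less_iff: "f \<in> homeo \<Longrightarrow> f x < f y \<longleftrightarrow> x < y"
  and homeo_le_iff: "f \<in> homeo \<Longrightarrow> f x \<le> f y \<longleftrightarrow> x \<le> y"
  and homeo_eq_iff: "f \<in> homeo \<Longrightarrow> f x = f y \<longleftrightarrow> x = y"
  using homeo_strict_mono by (simp_all add: strict_mono_less strict_mono_less_eq strict_mono_eq)

lemma hinv_left [simp]: "f \<in> homeo \<Longrightarrow> hinv f (f x) = x"
  and hinv_right [simp]: "f \<in> homeo \<Longrightarrow> f (hinv f x) = x"
  using HP.l_inv[of f] HP.r_inv[of f] by (simp_all add: fun_eq_iff)

lemma hinv_eq_iff: "f \<in> homeo \<Longrightarrow> hinv f x = y \<longleftrightarrow> x = f y"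
  by (metis hinv_left hinv_right)

lemma hinv_fix_iff: "f \<in> homeo \<Longrightarrow> hinv f x = x \<longleftrightarrow> f x = x"
  by (metis hinv_eq_iff)

lemma hinv_less_iff: "f \<in> homeo \<Longrightarrow> hinv f x < y \<longleftrightarrow> x < f y"
  and less_hinv_iff: "f \<in> homeo \<Longrightarrow> y < hinv f x \<longleftrightarrow> f y < x"
  and hinv_le_iff: "f \<in> homeo \<Longrightarrow> hinv f x \<le> y \<longleftrightarrow> x \<le> f y"
  and le_hinv_iff: "f \<in> homeo \<Longrightarrow> y \<le> hinv f x \<longleftrightarrow> f y \<le> x"
  by (metis hinv_right homeo_less_iff homeo_le_iff)+

lemma homeo_conj_fix_iff:
  assumes "f \<in> homeo" "w \<in> homeo"
  shows "(w \<circ> f \<circ> hinv w) x = x \<longleftrightarrow> f (hinv w x) = hinv w x"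
  using assms by (metis comp_apply hinv_eq_iff)

text \<open>If \<open>f\<close> moves \<open>x\<close>, it also moves \<open>f x\<close> by
  injectivity, so \<open>g\<close> fixes both points.\<close>

lemma homeo_commute_disjoint:
  assumes "f \<in> homeo" "g \<in> homeo" "\<And>x. f x = x \<or> g x = x"
  shows "f \<circ> g = g \<circ> f"
proof
  fix x
  show "(f \<circ> g) x = (g \<circ> f) x"
    using assms(3)[of x] assms(3)[of "f x"] assms(3)[of "g x"] homeo_eq_iff[OF assms(1)]
      homeo_eq_iff[OF assms(2)] by auto
qed

lemma generate_closed_Homeo:
  assumes "S \<subseteq> homeo"
  shows "id \<in> generate Homeo_plus S"
    and "f \<in> generate Homeo_plus S \<Longrightarrow> g \<in> generate Homeo_plus S \<Longrightarrow> f \<circ> g \<in> generate Homeo_plus S"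
    and "f \<in> generate Homeo_plus S \<Longrightarrow> hinv f \<in> generate Homeo_plus S"
    and "f \<in> generate Homeo_plus S \<Longrightarrow> f \<in> homeo"
  using generate.one[of Homeo_plus S] generate.eng[of f Homeo_plus S g]
    HP.generate_m_inv_closed[OF assms] HP.generate_in_carrier[OF assms] by auto

lemma generate_Homeo_induct [consumes 2, case_names one gen inv mult]:
  assumes "h \<in> generate Homeo_plus S" "S \<subseteq> homeo" "P id"
    and "\<And>s. s \<in> S \<Longrightarrow> s \<in> homeo \<Longrightarrow> P s"
    and "\<And>s. s \<in> S \<Longrightarrow> s \<in> homeo \<Longrightarrow> P (hinv s)"
    and "\<And>f g. f \<in> generate Homeo_plus S \<Longrightarrow> g \<in> generate Homeo_plus S \<Longrightarrow>
            f \<in> homeo \<Longrightarrow> g \<in> homeo \<Longrightarrow> P f \<Longrightarrow> P g \<Longrightarrow> P (f \<circ> g)"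
  shows "P h"
  using assms(1)
proof (induction rule: generate.induct)
  case (eng f g)
  then show ?case
    using assms(6)[of f g] generate_closed_Homeo(4)[OF assms(2)] by (simp del: comp_apply)
qed (use assms in \<open>auto simp del: id_apply\<close>)

section \<open>A criterion for simplicity of the commutator subgroup\<close>

text \<open>
  Linearity of the generators near \<open>a\<close> and \<open>L\<close> ensures that commutators have compact support in
  \<open>(a, L)\<close>.
\<close>

locale contracting_group =
  fixes S :: "(real \<Rightarrow> real) set" and a L :: real
  assumes S_homeo: "S \<subseteq> homeo"
    and S_fix: "s \<in> S \<Longrightarrow> x \<le> a \<or> L \<le> x \<Longrightarrow> s x = x"
    and S_germ_left: "s \<in> S \<Longrightarrow> \<exists>r>0. \<exists>e>a. \<forall>x\<in>{a..e}. s x = a + r * (x - a)"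
    and S_germ_right: "s \<in> S \<Longrightarrow> \<exists>r>0. \<exists>e<L. \<forall>x\<in>{e..L}. s x = L - r * (L - x)"
    and contract: "a < p \<Longrightarrow> p \<le> q \<Longrightarrow> q < L \<Longrightarrow> a \<le> u \<Longrightarrow> u < v \<Longrightarrow> v \<le> L \<Longrightarrow>
      \<exists>g\<in>generate Homeo_plus S. u < g p \<and> g q < v"
    and one_sided: "s \<in> S \<Longrightarrow> (\<exists>r<L. \<forall>x\<ge>r. s x = x) \<or> (\<exists>l>a. \<forall>x\<le>l. s x = x)"
    and opposite: "s \<in> S \<Longrightarrow> t \<in> S \<Longrightarrow> s \<noteq> t \<Longrightarrow>
      (\<exists>r<L. \<forall>x\<ge>r. s x = x) \<and> (\<exists>l>a. \<forall>x\<le>l. t x = x) \<or>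
      (\<exists>r<L. \<forall>x\<ge>r. t x = x) \<and> (\<exists>l>a. \<forall>x\<le>l. s x = x)"
    and noncommuting: "\<exists>s\<in>S. \<exists>t\<in>S. s \<circ> t \<noteq> t \<circ> s"
begin

definition K :: "(real \<Rightarrow> real) set" where
  "K = generate Homeo_plus S"

definition D :: "(real \<Rightarrow> real) set" where
  "D = derived Homeo_plus K"

lemma K_homeo: "g \<in> K \<Longrightarrow> g \<in> homeo"
  and K_comp: "g \<in> K \<Longrightarrow> h \<in> K \<Longrightarrow> g \<circ> h \<in> K"
  and K_inv: "g \<in> K \<Longrightarrow> hinv g \<in> K"
  using generate_closed_Homeo[OF S_homeo] by (auto simp: K_def)

lemma subgroup_K: "subgroup K Homeo_plus"
  unfolding K_def using S_homeo by (rule HP.generate_is_subgroup)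

lemma subgroup_D: "subgroup D Homeo_plus"
  unfolding D_def using subgroup.subset[OF subgroup_K] by (rule HP.derived_is_subgroup)

lemma D_subset_K: "D \<subseteq> K"
  unfolding D_def using subgroup_K by (intro HP.derived_incl) auto

lemma D_homeo: "g \<in> D \<Longrightarrow> g \<in> homeo"
  and D_comp: "g \<in> D \<Longrightarrow> h \<in> D \<Longrightarrow> g \<circ> h \<in> D"
  and D_inv: "g \<in> D \<Longrightarrow> hinv g \<in> D"
  and D_id: "id \<in> D"
  using subgroup.m_closed[OF subgroup_D] subgroup.m_inv_closed[OF subgroup_D]
    subgroup.one_closed[OF subgroup_D] D_subset_K K_homeo by auto

lemma commutator_D: "g \<in> K \<Longrightarrow> h \<in> K \<Longrightarrow> HP.commutator g h \<in> D"
  unfolding D_def by (rule HP.commutator_in_derived)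

lemma K_induct [consumes 1, case_names one gen inv mult]:
  assumes "h \<in> K" "P id"
    and "\<And>s. s \<in> S \<Longrightarrow> s \<in> K \<Longrightarrow> P s"
    and "\<And>s. s \<in> S \<Longrightarrow> s \<in> K \<Longrightarrow> P (hinv s)"
    and "\<And>f g. f \<in> K \<Longrightarrow> g \<in> K \<Longrightarrow> P f \<Longrightarrow> P g \<Longrightarrow> P (f \<circ> g)"
  shows "P h"
  using assms(1)[unfolded K_def] S_homeo
  by (induction rule: generate_Homeo_induct) (use assms(2-5) in \<open>auto simp: K_def generate.incl simp del: id_apply comp_apply\<close>)

lemma K_fix: "g \<in> K \<Longrightarrow> x \<le> a \<or> L \<le> x \<Longrightarrow> g x = x"
proof (induction arbitrary: x rule: K_induct)
  case (inv s)
  then show ?case using S_fix K_homeo by (simp add: hinv_fix_iff)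
qed (use S_fix in auto)

lemma K_inside:
  assumes "g \<in> K" "a < x" "x < L"
  shows "a < g x" "g x < L"
proof -
  have "g a = a" "g L = L"
    using K_fix[OF assms(1)] by auto
  then show "a < g x" "g x < L"
    using homeo_less_iff[OF K_homeo[OF assms(1)]] assms(2,3) by metis+
qed

lemma a_less_L: "a < L"
proof -
  obtain s t where "s \<in> S" "s \<circ> t \<noteq> t \<circ> s" using noncommuting by blast
  moreover have "s = id" if "L \<le> a"
    using S_fix[OF \<open>s \<in> S\<close>] that by (intro ext) (metis id_apply linorder_linear order_trans)
  ultimately show ?thesis by force
qed

section \<open>Germs at the two ends and compact supports\<close>

lemma K_germ_left: "g \<in> K \<Longrightarrow> \<exists>r>0. \<exists>e>a. \<forall>x\<in>{a..e}. g x = a + r * (x - a)"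
proof (induction rule: K_induct)
  case one
  show ?case by (intro exI[of _ 1] exI[of _ "a + 1"] conjI) auto
next
  case (gen s)
  then show ?case using S_germ_left by blast
next
  case (inv s)
  then obtain r e where re: "r > 0" "e > a" "\<forall>x\<in>{a..e}. s x = a + r * (x - a)"
    using S_germ_left by blast
  have "hinv s x = a + inverse r * (x - a)" if "x \<in> {a..a + r * (e - a)}" for x
  proof -
    have "a + inverse r * (x - a) \<in> {a..e}"
      using that re by (auto simp: field_simps)
    then have "s (a + inverse r * (x - a)) = a + r * (a + inverse r * (x - a) - a)"
      using re by blast
    then have "s (a + inverse r * (x - a)) = x"
      using re by (simp flip: mult.assoc)
    then show ?thesis using inv K_homeo by (simp add: hinv_eq_iff)
  qed
  moreover have "a + r * (e - a) > a" "inverse r > 0" using re by auto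
  ultimately show ?case by blast
next
  case (mult f g)
  then obtain r e r' e' where re: "r > 0" "e > a" "\<forall>x\<in>{a..e}. f x = a + r * (x - a)"
    "r' > 0" "e' > a" "\<forall>x\<in>{a..e'}. g x = a + r' * (x - a)" by blast
  have "(f \<circ> g) x = a + (r * r') * (x - a)" if "x \<in> {a..min e' (a + (e - a) / r')}" for x
  proof -
    have "g x = a + r' * (x - a)" using that re by auto
    moreover have "r' * (x - a) \<le> e - a" using that re by (auto simp: field_simps)
    ultimately have "g x \<in> {a..e}" using that re by auto
    then show ?thesis using \<open>g x = a + r' * (x - a)\<close> re by auto
  qed
  moreover have "min e' (a + (e - a) / r') > a" "r * r' > 0" using re by auto
  ultimately show ?case by blast
qed

lemma K_germ_right: "g \<in> K \<Longrightarrow> \<exists>r>0. \<exists>e<L. \<forall>x\<in>{e..L}. g x = L - r * (L - x)"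
proof (induction rule: K_induct)
  case one
  show ?case by (intro exI[of _ 1] exI[of _ "L - 1"] conjI) auto
next
  case (gen s)
  then show ?case using S_germ_right by blast
next
  case (inv s)
  then obtain r e where re: "r > 0" "e < L" "\<forall>x\<in>{e..L}. s x = L - r * (L - x)"
    using S_germ_right by blast
  have "hinv s x = L - inverse r * (L - x)" if "x \<in> {L - r * (L - e)..L}" for x
  proof -
    have "L - inverse r * (L - x) \<in> {e..L}"
      using that re by (auto simp: field_simps)
    then have "s (L - inverse r * (L - x)) = L - r * (L - (L - inverse r * (L - x)))"
      using re by blast
    then have "s (L - inverse r * (L - x)) = x"
      using re by (simp flip: mult.assoc)
    then show ?thesis using inv K_homeo by (simp add: hinv_eq_iff)
  qed
  moreover have "L - r * (L - e) < L" "inverse r > 0" using re by auto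
  ultimately show ?case by blast
next
  case (mult f g)
  then obtain r e r' e' where re: "r > 0" "e < L" "\<forall>x\<in>{e..L}. f x = L - r * (L - x)"
    "r' > 0" "e' < L" "\<forall>x\<in>{e'..L}. g x = L - r' * (L - x)" by blast
  have "(f \<circ> g) x = L - (r * r') * (L - x)" if "x \<in> {max e' (L - (L - e) / r')..L}" for x
  proof -
    have "g x = L - r' * (L - x)" using that re by auto
    moreover have "r' * (L - x) \<le> L - e" using that re by (auto simp: field_simps)
    ultimately have "g x \<in> {e..L}" using that re by auto
    then show ?thesis using \<open>g x = L - r' * (L - x)\<close> re by auto
  qed
  moreover have "max e' (L - (L - e) / r') < L" "r * r' > 0" using re by auto
  ultimately show ?case by blast
qed

text \<open>Near \<open>a\<close> both maps are linear with the common fixed point \<open>a\<close>,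
  and such maps commute; so the commutator has trivial germ there.\<close>

lemma commutator_fix_left:
  assumes "g \<in> K" "h \<in> K"
  shows "\<exists>p>a. \<forall>x\<le>p. HP.commutator g h x = x"
proof -
  obtain r e where g: "r > 0" "e > a" "\<forall>x\<in>{a..e}. g x = a + r * (x - a)"
    using K_germ_left[OF assms(1)] by blast
  obtain r' e' where h: "r' > 0" "e' > a" "\<forall>x\<in>{a..e'}. h x = a + r' * (x - a)"
    using K_germ_left[OF assms(2)] by blast
  \<comment> \<open>Up to \<open>m\<close>, a point and its images under \<open>g\<close> and
    \<open>h\<close> all stay where the map applied next is linear.\<close>
  define m where "m = min (min e e') (min (a + (e' - a) / r) (a + (e - a) / r'))"
  have m: "m > a" using g h by (auto simp: m_def)
  have gh: "g (h x) = h (g x)" if "x \<in> {a..m}" for x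
  proof -
    have "r' * (x - a) \<le> e - a" "r * (x - a) \<le> e' - a" and x: "x \<in> {a..e}" "x \<in> {a..e'}"
      using that g h by (auto simp: m_def field_simps)
    have gx: "g x = a + r * (x - a)" and hx: "h x = a + r' * (x - a)"
      using g h x by blast+
    then have "h x \<in> {a..e}" "g x \<in> {a..e'}"
      using g h x \<open>r' * (x - a) \<le> e - a\<close> \<open>r * (x - a) \<le> e' - a\<close> by auto
    then have "g (h x) = a + r * (h x - a)" "h (g x) = a + r' * (g x - a)"
      using g h by blast+
    then show ?thesis by (simp add: gx hx)
  qed
  \<comment> \<open>The bound is the condition \<open>hinv g (hinv h x) \<le> m\<close>, under which
    \<open>g\<close> and \<open>h\<close> can be interchanged.\<close>
  have "HP.commutator g h x = x" if "x \<le> h (g m)" for x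
  proof (cases "x \<le> a")
    case True
    then show ?thesis
      using K_fix[OF assms(1)] K_fix[OF assms(2)] K_fix[OF K_inv[OF assms(1)]] K_fix[OF K_inv[OF assms(2)]]
      by (simp add: HP.commutator_def)
  next
    case False
    let ?y = "hinv g (hinv h x)"
    have "?y \<le> m" using that by (simp add: hinv_le_iff K_homeo assms)
    moreover have "g a = a" "h a = a" using K_fix assms by auto
    then have "a \<le> ?y" using False by (simp add: le_hinv_iff K_homeo assms)
    ultimately show ?thesis
      using gh[of ?y] by (simp add: HP.commutator_def K_homeo assms)
  qed
  moreover have "h (g m) > a"
    using m K_fix[OF assms(1), of a] K_fix[OF assms(2), of a]
      homeo_less_iff[OF K_homeo[OF assms(1)], of a m] homeo_less_iff[OF K_homeo[OF assms(2)], of a "g m"]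
    by auto
  ultimately show ?thesis by blast
qed

lemma commutator_fix_right:
  assumes "g \<in> K" "h \<in> K"
  shows "\<exists>q<L. \<forall>x\<ge>q. HP.commutator g h x = x"
proof -
  obtain r e where g: "r > 0" "e < L" "\<forall>x\<in>{e..L}. g x = L - r * (L - x)"
    using K_germ_right[OF assms(1)] by blast
  obtain r' e' where h: "r' > 0" "e' < L" "\<forall>x\<in>{e'..L}. h x = L - r' * (L - x)"
    using K_germ_right[OF assms(2)] by blast
  define m where "m = max (max e e') (max (L - (L - e') / r) (L - (L - e) / r'))"
  have m: "m < L" using g h by (auto simp: m_def)
  have gh: "g (h x) = h (g x)" if "x \<in> {m..L}" for x
  proof -
    have "r' * (L - x) \<le> L - e" "r * (L - x) \<le> L - e'" and x: "x \<in> {e..L}" "x \<in> {e'..L}"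
      using that g h by (auto simp: m_def field_simps)
    have gx: "g x = L - r * (L - x)" and hx: "h x = L - r' * (L - x)"
      using g h x by blast+
    then have "h x \<in> {e..L}" "g x \<in> {e'..L}"
      using g h x \<open>r' * (L - x) \<le> L - e\<close> \<open>r * (L - x) \<le> L - e'\<close> by auto
    then have "g (h x) = L - r * (L - h x)" "h (g x) = L - r' * (L - g x)"
      using g h by blast+
    then show ?thesis by (simp add: gx hx)
  qed
  have "HP.commutator g h x = x" if "x \<ge> h (g m)" for x
  proof (cases "x \<ge> L")
    case True
    then show ?thesis
      using K_fix[OF assms(1)] K_fix[OF assms(2)] K_fix[OF K_inv[OF assms(1)]] K_fix[OF K_inv[OF assms(2)]]
      by (simp add: HP.commutator_def)
  next
    case False
    let ?y = "hinv g (hinv h x)"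
    have "?y \<ge> m" using that by (simp add: le_hinv_iff K_homeo assms)
    moreover have "g L = L" "h L = L" using K_fix assms by auto
    then have "?y \<le> L" using False by (simp add: hinv_le_iff K_homeo assms)
    ultimately show ?thesis
      using gh[of ?y] by (simp add: HP.commutator_def K_homeo assms)
  qed
  moreover have "h (g m) < L"
    using m K_fix[OF assms(1), of L] K_fix[OF assms(2), of L]
      homeo_less_iff[OF K_homeo[OF assms(1)], of m L] homeo_less_iff[OF K_homeo[OF assms(2)], of "g m" L]
    by auto
  ultimately show ?thesis by blast
qed

lemma D_compact_support:
  assumes "g \<in> D"
  shows "\<exists>p q. a < p \<and> p \<le> q \<and> q < L \<and> (\<forall>x. x \<le> p \<or> q \<le> x \<longrightarrow> g x = x)"
proof -
  have "(\<exists>p>a. \<forall>x\<le>p. g x = x) \<and> (\<exists>q<L. \<forall>x\<ge>q. g x = x)"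
    using assms[unfolded D_def derived_def] HP.derived_set_in_carrier[OF subgroup.subset[OF subgroup_K]]
  proof (induction rule: generate_Homeo_induct)
    case one
    show ?case by (auto intro: exI[of _ "a + 1"] exI[of _ "L - 1"])
  next
    case (gen s)
    then show ?case
      using commutator_fix_left commutator_fix_right by (auto simp: HP.commutator_def)
  next
    case (inv s)
    then have "(\<exists>p>a. \<forall>x\<le>p. s x = x) \<and> (\<exists>q<L. \<forall>x\<ge>q. s x = x)"
      using commutator_fix_left commutator_fix_right by (auto simp: HP.commutator_def)
    then show ?case using inv(2) by (simp add: hinv_fix_iff)
  next
    case (mult f g)
    obtain p q where pq: "p > a" "\<forall>x\<le>p. f x = x" "q < L" "\<forall>x\<ge>q. f x = x"
      using mult.IH(1) by blast
    obtain p' q' where pq': "p' > a" "\<forall>x\<le>p'. g x = x" "q' < L" "\<forall>x\<ge>q'. g x = x"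
      using mult.IH(2) by blast
    from pq pq' show ?case
      by (intro conjI exI[of _ "min p p'"] exI[of _ "max q q'"]) auto
  qed
  then obtain p q where pq: "p > a" "\<forall>x\<le>p. g x = x" "q < L" "\<forall>x\<ge>q. g x = x" by blast
  \<comment> \<open>The midpoint separates the two bounds; they are otherwise unrelated, for
    instance when \<open>g\<close> is the identity.\<close>
  show ?thesis
    using pq a_less_L
    by (intro exI[of _ "min p ((a + L) / 2)"] exI[of _ "max q ((a + L) / 2)"]) auto
qed

text \<open>
  A group element is corrected to a commutator \<open>s w s\<^sup>-\<^sup>1 w\<^sup>-\<^sup>1\<close>, where \<open>w\<close> moves the support of
  \<open>s\<close> off the given compact interval.
\<close>

lemma approx_one_sided:
  assumes "s \<in> K" "(\<exists>r<L. \<forall>x\<ge>r. s x = x) \<or> (\<exists>l>a. \<forall>x\<le>l. s x = x)" "a < p" "q < L"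
  shows "\<exists>w\<in>K. \<forall>x. p \<le> x \<and> x \<le> q \<longrightarrow> (w \<circ> hinv s \<circ> hinv w) x = x"
  using assms(2)
proof
  assume "\<exists>r<L. \<forall>x\<ge>r. s x = x"
  then obtain r where r: "r < L" "\<forall>x\<ge>r. s x = x" by blast
  \<comment> \<open>\<open>r\<close> may lie to the left of \<open>a\<close>, whereas
    \<open>contract\<close> needs a point of the open interval.\<close>
  define r' where "r' = max r ((a + L) / 2)"
  have r': "a < r'" "r' < L" using r a_less_L by (auto simp: r'_def less_max_iff_disj)
  obtain w where w: "w \<in> K" "w r' < min p L"
    using contract[of r' r' a "min p L"] r' assms(3) a_less_L by (auto simp: K_def)
  have "hinv s (hinv w x) = hinv w x" if "p \<le> x" for x
  proof -
    have "r' \<le> hinv w x" using w that by (simp add: le_hinv_iff K_homeo)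
    then show ?thesis using r assms(1) by (simp add: hinv_eq_iff K_homeo r'_def)
  qed
  then show ?thesis
    using w(1) K_homeo by (intro bexI[of _ w]) auto
next
  assume "\<exists>l>a. \<forall>x\<le>l. s x = x"
  then obtain l where l: "l > a" "\<forall>x\<le>l. s x = x" by blast
  define l' where "l' = min l ((a + L) / 2)"
  have l': "a < l'" "l' < L" using l a_less_L by (auto simp: l'_def min_less_iff_disj)
  obtain w where w: "w \<in> K" "max q a < w l'"
    using contract[of l' l' "max q a" L] l' assms(4) a_less_L by (auto simp: K_def)
  have "hinv s (hinv w x) = hinv w x" if "x \<le> q" for x
  proof -
    have "hinv w x \<le> l'" using w that by (simp add: hinv_le_iff K_homeo)
    then show ?thesis using l assms(1) by (simp add: hinv_eq_iff K_homeo l'_def)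
  qed
  then show ?thesis
    using w(1) K_homeo by (intro bexI[of _ w]) auto
qed

text \<open>As long as only a compact interval is observed, \<open>K\<close> can be replaced by
  \<open>D\<close>. For a product the left factor is approximated on the image of the interval under
  the right one, so the induction is over all \<open>p\<close> and \<open>q\<close>.\<close>

lemma approx:
  assumes "g \<in> K" "a < p" "p \<le> q" "q < L"
  shows "\<exists>h\<in>D. \<forall>x. p \<le> x \<and> x \<le> q \<longrightarrow> h x = g x"
proof -
  have gen_case: "\<exists>h\<in>D. \<forall>x. p \<le> x \<and> x \<le> q \<longrightarrow> h x = s x"
    if s: "s \<in> K" "(\<exists>r<L. \<forall>x\<ge>r. s x = x) \<or> (\<exists>l>a. \<forall>x\<le>l. s x = x)" and pq: "a < p" "q < L" for s p q
  proof -
    obtain w where w: "w \<in> K" "\<forall>x. p \<le> x \<and> x \<le> q \<longrightarrow> (w \<circ> hinv s \<circ> hinv w) x = x"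
      using approx_one_sided[OF s pq] by blast
    have "HP.commutator s w x = s ((w \<circ> hinv s \<circ> hinv w) x)" for x
      by (simp add: HP.commutator_def)
    then show ?thesis
      using w commutator_D[OF s(1) w(1)] by metis
  qed
  show ?thesis
    using assms
  proof (induction arbitrary: p q rule: K_induct)
    case one
    then show ?case using D_id by (intro bexI[of _ id]) auto
  next
    case (gen s)
    then show ?case using gen_case[of s p q] one_sided by blast
  next
    case (inv s)
    have "hinv s \<in> K" using inv(2) by (rule K_inv)
    moreover have "(\<exists>r<L. \<forall>x\<ge>r. hinv s x = x) \<or> (\<exists>l>a. \<forall>x\<le>l. hinv s x = x)"
      using one_sided[OF inv(1)] K_homeo[OF inv(2)] by (simp add: hinv_fix_iff)
    ultimately show ?case using gen_case[of "hinv s" p q] inv by blast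
  next
    case (mult f g)
    note g = mult.hyps(2)
    obtain h where h: "h \<in> D" "\<forall>x. p \<le> x \<and> x \<le> q \<longrightarrow> h x = g x"
      using mult by blast
    have "a < g p" "g p \<le> g q" "g q < L"
      using K_inside[OF g, of p] K_inside[OF g, of q] mult.prems K_homeo[OF g] by (auto simp: homeo_le_iff)
    then obtain k where k: "k \<in> D" "\<forall>x. g p \<le> x \<and> x \<le> g q \<longrightarrow> k x = f x"
      using mult.IH(1) by blast
    have "\<forall>x. p \<le> x \<and> x \<le> q \<longrightarrow> (k \<circ> h) x = (f \<circ> g) x"
      using h k homeo_le_iff[OF K_homeo[OF g]] by auto
    then show ?case using D_comp[OF k(1) h(1)] by blast
  qed
qed

section \<open>Perfectness and simplicity of \<open>D\<close>\<close>

lemma contract_D: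
  assumes "a < p" "p \<le> q" "q < L" "a \<le> u" "u < v" "v \<le> L"
  shows "\<exists>g\<in>D. u < g p \<and> g q < v"
proof -
  obtain g where g: "g \<in> K" "u < g p" "g q < v"
    using contract[OF assms] by (auto simp: K_def)
  obtain h where "h \<in> D" "h p = g p" "h q = g q"
    using approx[OF g(1) assms(1-3)] assms(2) by auto
  then show ?thesis using g by (intro bexI[of _ h]) auto
qed

text \<open>\<open>s1\<close> is the commutator of \<open>s\<close> with \<open>w\<close>: it is
  \<open>s\<close> times a conjugate of its inverse that has been pushed to the left, where
  \<open>t\<close> is trivial. So \<open>s1\<close> and \<open>s\<close> have the same commutator
  with \<open>t\<close>. As \<open>s1\<close> has compact support, \<open>t\<close> can be corrected
  likewise to \<open>t1\<close> by a factor living to the right of that support. Both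
  \<open>s1\<close> and \<open>t1\<close> are in \<open>D\<close>.\<close>

lemma commutator_in_derived_D:
  assumes "s \<in> K" "t \<in> K" "\<exists>r<L. \<forall>x\<ge>r. s x = x" "\<exists>l>a. \<forall>x\<le>l. t x = x"
  shows "HP.commutator s t \<in> derived Homeo_plus D"
proof -
  obtain r l where r: "r < L" "\<forall>x\<ge>r. s x = x" and l: "l > a" "\<forall>x\<le>l. t x = x"
    using assms by blast
  define r' where "r' = max r ((a + L) / 2)"
  define l' where "l' = min l ((a + L) / 2)"
  have r': "a < r'" "r' < L" "\<forall>x\<ge>r'. s x = x" and l': "a < l'" "l' < L" "\<forall>x\<le>l'. t x = x"
    using r l a_less_L by (auto simp: r'_def l'_def less_max_iff_disj min_less_iff_disj)
  obtain w where w: "w \<in> K" "w r' < l'"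
    using contract[of r' r' a l'] r' l' by (auto simp: K_def)
  define \<rho> where "\<rho> = w \<circ> hinv s \<circ> hinv w"
  define s1 where "s1 = s \<circ> \<rho>"
  have \<rho>K: "\<rho> \<in> K" unfolding \<rho>_def using assms w K_comp K_inv by simp
  have s1D: "s1 \<in> D"
    using commutator_D[OF assms(1) w(1)] by (simp add: s1_def \<rho>_def HP.commutator_def comp_assoc)
  have "\<rho> x = x" if "w r' \<le> x" for x
  proof -
    have "r' \<le> hinv w x" using that w by (simp add: le_hinv_iff K_homeo)
    then have "hinv s (hinv w x) = hinv w x" using r' assms by (simp add: hinv_eq_iff K_homeo)
    then show ?thesis using w by (simp add: \<rho>_def K_homeo)
  qed
  then have \<rho>t: "\<rho> \<circ> t = t \<circ> \<rho>"
  proof (intro homeo_commute_disjoint)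
    fix x
    show "\<rho> x = x \<or> t x = x"
      using \<open>\<And>x. w r' \<le> x \<Longrightarrow> \<rho> x = x\<close>[of x] l'(3) w(2) by (cases "w r' \<le> x") auto
  qed (use \<rho>K assms K_homeo in auto)
  obtain p q where q: "a < p" "p \<le> q" "q < L" "\<forall>x. x \<le> p \<or> q \<le> x \<longrightarrow> s1 x = x"
    using D_compact_support[OF s1D] by blast
  obtain w2 where w2: "w2 \<in> K" "q < w2 l'"
    using contract[of l' l' q L] q l' by (auto simp: K_def)
  define \<sigma> where "\<sigma> = w2 \<circ> hinv t \<circ> hinv w2"
  define t1 where "t1 = t \<circ> \<sigma>"
  have \<sigma>K: "\<sigma> \<in> K" unfolding \<sigma>_def using assms w2 K_comp K_inv by simp
  have t1D: "t1 \<in> D"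
    using commutator_D[OF assms(2) w2(1)] by (simp add: t1_def \<sigma>_def HP.commutator_def comp_assoc)
  have "\<sigma> x = x" if "x \<le> w2 l'" for x
  proof -
    have "hinv w2 x \<le> l'" using that w2 by (simp add: hinv_le_iff K_homeo)
    then have "hinv t (hinv w2 x) = hinv w2 x" using l' assms by (simp add: hinv_eq_iff K_homeo)
    then show ?thesis using w2 by (simp add: \<sigma>_def K_homeo)
  qed
  then have s1\<sigma>: "\<sigma> \<circ> s1 = s1 \<circ> \<sigma>"
  proof (intro homeo_commute_disjoint)
    fix x
    show "\<sigma> x = x \<or> s1 x = x"
      using \<open>\<And>x. x \<le> w2 l' \<Longrightarrow> \<sigma> x = x\<close>[of x] q(4) w2(2) by (cases "x \<le> w2 l'") auto
  qed (use \<sigma>K s1D K_homeo D_homeo in auto)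
  have "HP.commutator s1 t1 = HP.commutator s1 t"
    using HP.commutator_mult_right[of s1 \<sigma> t] s1\<sigma> s1D \<sigma>K assms K_homeo D_homeo by (simp add: t1_def)
  also have "\<dots> = HP.commutator s t"
    using HP.commutator_mult_left[of s \<rho> t] \<rho>t \<rho>K assms K_homeo by (simp add: s1_def)
  finally show ?thesis
    using HP.commutator_in_derived[OF s1D t1D] by simp
qed

text \<open>The derived subgroup of \<open>D\<close> is normal in \<open>K\<close>, and by
  \<open>opposite\<close> any two distinct generators satisfy the hypotheses of
  \<open>commutator_in_derived_D\<close> in some order, so they commute modulo it. Hence it contains
  all commutators of \<open>K\<close>. Perfectness is what lets Higman's argument, which only
  captures commutators of elements of \<open>D\<close>, reach all of \<open>D\<close>.\<close>

lemma derived_D: "derived Homeo_plus D = D"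
proof
  show "derived Homeo_plus D \<subseteq> D"
    using subgroup_D by (intro HP.derived_incl) auto
  let ?G = "Homeo_plus\<lparr>carrier := K\<rparr>"
  interpret G: group ?G
    using subgroup_K by (rule HP.subgroup_imp_group)
  have inv: "inv\<^bsub>?G\<^esub> g = hinv g" if "g \<in> K" for g
    using HP.m_inv_consistent[OF subgroup_K that] .
  have comm: "G.commutator g h = HP.commutator g h" if "g \<in> K" "h \<in> K" for g h
    using that by (simp add: G.commutator_def HP.commutator_def inv)
  have D: "derived ?G K = D" "derived ?G D = derived Homeo_plus D"
    using HP.derived_consistent[OF _ subgroup_K] D_subset_K by (simp_all add: D_def)
  have "D \<lhd> ?G"
    using G.derived_self_is_normal by (simp add: D)
  then have normal: "derived Homeo_plus D \<lhd> ?G"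
    using G.derived_is_normal[of D] by (simp add: D)
  have SK: "S \<subseteq> K" by (auto simp: K_def generate.incl)
  have "derived ?G (carrier ?G) \<subseteq> derived Homeo_plus D"
  proof (rule G.derived_generate_subset_normal[OF normal])
    show "S \<subseteq> carrier ?G" using SK by simp
    show "carrier ?G = generate ?G S"
      using HP.generate_consistent[OF SK subgroup_K] by (simp add: K_def)
    fix s t assume st: "s \<in> S" "t \<in> S"
    then have K: "s \<in> K" "t \<in> K" using SK by auto
    have "HP.commutator s t \<in> derived Homeo_plus D"
    proof (cases "s = t")
      case True
      then have "HP.commutator s t = id"
        using K K_homeo HP.commutator_eq_one_iff[of s t] by simp
      then show ?thesis
        using subgroup.one_closed[OF HP.derived_is_subgroup[OF subgroup.subset[OF subgroup_D]]] by simp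
    next
      case False
      from opposite[OF st this] show ?thesis
      proof
        assume "(\<exists>r<L. \<forall>x\<ge>r. s x = x) \<and> (\<exists>l>a. \<forall>x\<le>l. t x = x)"
        then show ?thesis using commutator_in_derived_D[OF K] by blast
      next
        assume "(\<exists>r<L. \<forall>x\<ge>r. t x = x) \<and> (\<exists>l>a. \<forall>x\<le>l. s x = x)"
        then have "HP.commutator t s \<in> derived Homeo_plus D"
          using commutator_in_derived_D[OF K(2,1)] by blast
        then have "hinv (HP.commutator t s) \<in> derived Homeo_plus D"
          by (rule subgroup.m_inv_closed[OF HP.derived_is_subgroup[OF subgroup.subset[OF subgroup_D]]])
        then show ?thesis
          using HP.inv_commutator[of t s] K K_homeo by simp
      qed
    qed
    then show "G.commutator s t \<in> derived Homeo_plus D"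
      using comm K by simp
  qed
  then show "D \<subseteq> derived Homeo_plus D"
    by (simp add: D)
qed

text \<open>The open interval between a point and its image is disjoint from its own image. The
  point taken is the preimage of \<open>m\<close>, which is moved because \<open>m\<close> lies
  strictly between \<open>x\<close> and \<open>\<eta> x\<close>.\<close>

lemma displaced_interval:
  assumes "\<eta> \<in> K" "\<eta> \<noteq> id"
  shows "\<exists>u v. a \<le> u \<and> u < v \<and> v \<le> L \<and> (\<forall>x. u < x \<and> x < v \<longrightarrow> \<eta> x \<le> u \<or> v \<le> \<eta> x)"
proof -
  have \<eta>: "\<eta> \<in> homeo" using assms K_homeo by simp
  obtain x where x: "\<eta> x \<noteq> x" using assms by (auto simp: fun_eq_iff)
  have "a < x" "x < L" using K_fix[OF assms(1), of x] x by (auto simp flip: not_le)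
  then have in_aL: "a < \<eta> x" "\<eta> x < L" "a < x" "x < L"
    using K_inside[OF assms(1)] by auto
  define m where "m = (x + \<eta> x) / 2"
  have m: "a < m" "m < L" using in_aL by (auto simp: m_def)
  then have im: "a < hinv \<eta> m" "hinv \<eta> m < L"
    using K_inside[OF K_inv[OF assms(1)]] by auto
  show ?thesis
  proof (cases "\<eta> x > x")
    case True
    then have "x < m" "m < \<eta> x" by (auto simp: m_def)
    then have "hinv \<eta> m < m" using \<eta> by (metis hinv_less_iff less_trans)
    moreover have "m \<le> \<eta> y" if "hinv \<eta> m < y" for y
      using that \<eta> by (simp add: hinv_less_iff)
    ultimately show ?thesis
      using m im by (intro exI[of _ "hinv \<eta> m"] exI[of _ m]) auto
  next
    case False
    then have "m < x" "\<eta> x < m" using x by (auto simp: m_def)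
    then have "m < hinv \<eta> m" using \<eta> by (metis less_hinv_iff less_trans)
    moreover have "\<eta> y \<le> m" if "y < hinv \<eta> m" for y
      using that \<eta> by (simp add: less_hinv_iff)
    ultimately show ?thesis
      using m im by (intro exI[of _ m] exI[of _ "hinv \<eta> m"]) auto
  qed
qed

text \<open>Higman's argument. \<open>contract_D\<close> conjugates \<open>A\<close> and
  \<open>B\<close> into an interval that \<eta> moves off itself. Then the support of
  \<open>\<rho>\<close> is disjoint from that of \<open>B'\<close>, so replacing \<open>A'\<close>
  by \<open>A' \<circ> \<rho>\<close> does not change the commutator with \<open>B'\<close>. But
  \<open>A' \<circ> \<rho>\<close> is the commutator of \<open>A'\<close> and \<eta>, a conjugate of
  \<eta> times its inverse, and lies in \<open>N\<close>.\<close>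

lemma commutator_in_normal:
  assumes N: "N \<lhd> Homeo_plus\<lparr>carrier := D\<rparr>" and \<eta>: "\<eta> \<in> N" "\<eta> \<noteq> id" and AB: "A \<in> D" "B \<in> D"
  shows "HP.commutator A B \<in> N"
proof -
  let ?G = "Homeo_plus\<lparr>carrier := D\<rparr>"
  interpret G: group ?G
    using subgroup_D by (rule HP.subgroup_imp_group)
  interpret N: normal N ?G by fact
  have inv: "inv\<^bsub>?G\<^esub> g = hinv g" if "g \<in> D" for g
    using HP.m_inv_consistent[OF subgroup_D that] .
  have ND: "N \<subseteq> D" using N.subset by simp
  have N_inv: "hinv h \<in> N" if "h \<in> N" for h
    using subgroup.m_inv_closed[OF N.subgroup_axioms that] inv[of h] that ND by (metis subsetD)
  have N_comp: "g \<circ> h \<in> N" if "g \<in> N" "h \<in> N" for g h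
    using subgroup.m_closed[OF N.subgroup_axioms that] by simp
  have N_conj: "g \<circ> h \<circ> hinv g \<in> N" if "g \<in> D" "h \<in> N" for g h
    using N.inv_op_closed2[of g h] that inv by simp
  obtain u v where uv: "a \<le> u" "u < v" "v \<le> L" "\<forall>x. u < x \<and> x < v \<longrightarrow> \<eta> x \<le> u \<or> v \<le> \<eta> x"
    using displaced_interval[of \<eta>] \<eta> ND D_subset_K by blast
  obtain p1 q1 where 1: "a < p1" "p1 \<le> q1" "q1 < L" "\<forall>x. x \<le> p1 \<or> q1 \<le> x \<longrightarrow> A x = x"
    using D_compact_support[OF AB(1)] by blast
  obtain p2 q2 where 2: "a < p2" "p2 \<le> q2" "q2 < L" "\<forall>x. x \<le> p2 \<or> q2 \<le> x \<longrightarrow> B x = x"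
    using D_compact_support[OF AB(2)] by blast
  have "min p1 p2 \<le> max q1 q2" using 1 by auto
  then obtain g where g: "g \<in> D" "u < g (min p1 p2)" "g (max q1 q2) < v"
    using contract_D[of "min p1 p2" "max q1 q2" u v] 1 2 uv by auto
  note homeo = D_homeo[OF AB(1)] D_homeo[OF AB(2)] D_homeo[OF g(1)]
  have \<eta>h: "\<eta> \<in> homeo" using \<eta>(1) ND D_homeo by auto
  define A' B' where "A' = g \<circ> A \<circ> hinv g" and "B' = g \<circ> B \<circ> hinv g"
  have D': "A' \<in> D" "B' \<in> D"
    using AB g D_comp D_inv by (auto simp: A'_def B'_def)
  note homeo' = D_homeo[OF D'(1)] D_homeo[OF D'(2)]
  have supp: "A' x = x \<and> B' x = x" if "x \<le> u \<or> v \<le> x" for x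
  proof -
    have "hinv g x \<le> min p1 p2 \<or> max q1 q2 \<le> hinv g x"
      using that g hinv_le_iff[OF homeo(3)] le_hinv_iff[OF homeo(3)] by (metis less_imp_le order_trans)
    then show ?thesis
      using 1 2 homeo unfolding A'_def B'_def by (auto simp: homeo_conj_fix_iff simp del: comp_apply)
  qed
  define \<rho> where "\<rho> = \<eta> \<circ> hinv A' \<circ> hinv \<eta>"
  have \<rho>h: "\<rho> \<in> homeo" using \<eta>h homeo' homeo_comp by (simp add: \<rho>_def)
  have "\<rho> x = x \<or> B' x = x" for x
  proof (cases "u < x \<and> x < v")
    case True
    have "hinv \<eta> x \<le> u \<or> v \<le> hinv \<eta> x"
      using uv(4)[rule_format, of "hinv \<eta> x"] True \<eta>h by fastforce
    then have "hinv A' (hinv \<eta> x) = hinv \<eta> x"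
      using supp homeo' by (simp add: hinv_eq_iff)
    then show ?thesis using \<eta>h by (simp add: \<rho>_def)
  qed (use supp in auto)
  then have comm: "\<rho> \<circ> B' = B' \<circ> \<rho>"
    using \<rho>h homeo' by (intro homeo_commute_disjoint) auto
  have "A' \<circ> \<rho> \<in> N"
    using N_comp[OF N_conj[OF D'(1) \<eta>(1)] N_inv[OF \<eta>(1)]]
    by (simp add: \<rho>_def comp_assoc)
  moreover from this have "B' \<circ> hinv (A' \<circ> \<rho>) \<circ> hinv B' \<in> N"
    using N_conj[OF D'(2)] N_inv by simp
  ultimately have "HP.commutator (A' \<circ> \<rho>) B' \<in> N"
    using N_comp[of "A' \<circ> \<rho>"] by (simp add: HP.commutator_def comp_assoc)
  then have "HP.commutator A' B' \<in> N"
    using HP.commutator_mult_left[of A' \<rho> B'] comm \<rho>h homeo' by simp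
  then have "hinv g \<circ> (g \<circ> HP.commutator A B \<circ> hinv g) \<circ> hinv (hinv g) \<in> N"
    using HP.conj_commutator[of A B g] homeo N_conj[OF D_inv[OF g(1)]] by (simp add: A'_def B'_def)
  moreover have "hinv g \<circ> (g \<circ> HP.commutator A B \<circ> hinv g) \<circ> hinv (hinv g) = HP.commutator A B"
    using homeo by (simp add: fun_eq_iff)
  ultimately show ?thesis by simp
qed

lemma commutator_subgroup_eq:
  "commutator_subgroup (subgroup_generated Homeo_plus S) = Homeo_plus\<lparr>carrier := D\<rparr>"
proof -
  have "subgroup_generated Homeo_plus S = Homeo_plus\<lparr>carrier := K\<rparr>"
    using S_homeo by (simp add: subgroup_generated_def K_def Int_absorb1)
  then show ?thesis
    using HP.derived_consistent[OF order_refl subgroup_K] by (simp add: commutator_subgroup_def D_def)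
qed

lemma simple_commutator_subgroup:
  "is_simple (commutator_subgroup (subgroup_generated Homeo_plus S))"
proof -
  obtain s t where st: "s \<in> S" "t \<in> S" "s \<circ> t \<noteq> t \<circ> s" using noncommuting by blast
  then have "s \<in> K" "t \<in> K" by (auto simp: K_def generate.incl)
  then have "HP.commutator s t \<in> D" "HP.commutator s t \<noteq> id"
    using commutator_D HP.commutator_eq_one_iff[of s t] st K_homeo by auto
  then have nontrivial: "D \<noteq> {id}" by auto
  have "N = D" if N: "N \<lhd> Homeo_plus\<lparr>carrier := D\<rparr>" "N \<noteq> {id}" for N
  proof
    interpret N: normal N "Homeo_plus\<lparr>carrier := D\<rparr>" by fact
    show "N \<subseteq> D" using N.subset by simp
    obtain \<eta> where "\<eta> \<in> N" "\<eta> \<noteq> id" using subgroup.one_closed[OF N.subgroup_axioms] N(2) by auto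
    then have "derived_set Homeo_plus D \<subseteq> N"
      using commutator_in_normal[OF N(1)] by (auto simp: HP.commutator_def)
    moreover have "subgroup N Homeo_plus"
      using HP.incl_subgroup[OF subgroup_D N.subgroup_axioms] .
    ultimately have "derived Homeo_plus D \<subseteq> N"
      unfolding derived_def by (rule HP.generate_subgroup_incl)
    then show "D \<subseteq> N" by (simp add: derived_D)
  qed
  then show ?thesis
    using nontrivial HP.subgroup_imp_group[OF subgroup_D]
    by (auto simp: is_simple_def commutator_subgroup_eq)
qed

end

section \<open>Two overlapping homeomorphisms generate Thompson's group\<close>

lemma hinv_comp: "f \<in> homeo \<Longrightarrow> g \<in> homeo \<Longrightarrow> hinv (f \<circ> g) = hinv g \<circ> hinv f"
  using HP.inv_mult_group[of f g] by simp

lemma hinv_conj: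
  assumes "f \<in> homeo" "w \<in> homeo"
  shows "hinv (w \<circ> f \<circ> hinv w) = w \<circ> hinv f \<circ> hinv w"
  using assms by (simp only: hinv_comp homeo_comp HP.inv_closed HP.inv_inv comp_assoc)

lemma hinv_homeo [simp]: "f \<in> homeo \<Longrightarrow> hinv f \<in> homeo"
  by simp

text \<open>The images of the generators of F. Inverses are taken so that the first two families of
  relators conjugate by \<open>g \<circ> f\<close> and by \<open>g\<close>, which push supports to
  the right.\<close>

fun thompson_seq :: "(real \<Rightarrow> real) \<Rightarrow> (real \<Rightarrow> real) \<Rightarrow> nat \<Rightarrow> real \<Rightarrow> real" where
  "thompson_seq f g 0 = hinv (g \<circ> f)"
| "thompson_seq f g (Suc 0) = hinv g"
| "thompson_seq f g (Suc (Suc k)) = (g \<circ> f) \<circ> thompson_seq f g (Suc k) \<circ> hinv (g \<circ> f)"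

locale two_chain =
  fixes f g :: "real \<Rightarrow> real" and b :: real
  assumes f: "f \<in> homeo" "\<And>x. x \<le> f x" "b < f b" "\<And>x. g (f b) \<le> x \<Longrightarrow> f x = x"
    and g: "g \<in> homeo" "\<And>x. x \<le> g x" "\<And>x. x \<le> b \<Longrightarrow> g x = x" "g (f b) < g (g (f b))"
begin

definition X :: "real \<Rightarrow> real" where
  "X = g \<circ> f"

abbreviation y :: "nat \<Rightarrow> real \<Rightarrow> real" where
  "y \<equiv> thompson_seq f g"

lemma y_0: "y 0 = hinv X" and y_Suc: "y (Suc (Suc k)) = X \<circ> y (Suc k) \<circ> hinv X"
  by (simp_all add: X_def)

lemma X_homeo [simp]: "X \<in> homeo"
  unfolding X_def using f(1) g(1) by (rule homeo_comp[rotated])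

lemma X_ge: "x \<le> X x"
  using order_trans[OF f(2) g(2)] by (simp add: X_def)

lemma y_Suc_homeo: "y (Suc k) \<in> homeo"
proof (induction k)
  case 0
  show ?case using g(1) by simp
next
  case (Suc k)
  then show ?case unfolding y_Suc by (intro homeo_comp hinv_homeo X_homeo)
qed

lemma y_homeo [simp]: "y k \<in> homeo"
  using y_Suc_homeo by (cases k) (auto simp: y_0 simp del: thompson_seq.simps)

lemma y_Suc_fix: "x \<le> (X ^^ k) b \<Longrightarrow> y (Suc k) x = x"
proof (induction k arbitrary: x)
  case 0
  then show ?case using g by (simp add: hinv_fix_iff)
next
  case (Suc k)
  then have "y (Suc k) (hinv X x) = hinv X x"
    by (simp add: hinv_le_iff del: thompson_seq.simps)
  then show ?case by (simp add: y_Suc del: thompson_seq.simps)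
qed

lemma y_le: "y k x \<le> x"
proof -
  have "y (Suc j) x \<le> x" for j x
  proof (induction j arbitrary: x)
    case 0
    show ?case using g by (simp add: hinv_le_iff)
  next
    case (Suc j)
    have "X (y (Suc j) (hinv X x)) \<le> X (hinv X x)"
      unfolding homeo_le_iff[OF X_homeo] by (rule Suc.IH)
    then show ?case by (simp add: y_Suc del: thompson_seq.simps)
  qed
  then show ?thesis
    using X_ge by (cases k) (auto simp: y_0 hinv_le_iff simp del: thompson_seq.simps)
qed

lemma X_pow_mono: "i \<le> j \<Longrightarrow> (X ^^ i) b \<le> (X ^^ j) b"
  by (rule lift_Suc_mono_le[of "\<lambda>k. (X ^^ k) b"]) (simp add: X_ge)

lemma y_moves: "y k ((X ^^ k) b) < (X ^^ k) b"
proof (cases k)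
  case 0
  then show ?thesis
    using f(3) g(2)[of "f b"] by (simp add: hinv_less_iff y_0 X_def del: thompson_seq.simps flip: X_def)
      (simp add: X_def)
next
  case (Suc j)
  have "y (Suc j) ((X ^^ Suc j) b) < (X ^^ Suc j) b"
  proof (induction j)
    case 0
    show ?case using g homeo_less_iff[OF g(1), of "f b" "g (f b)"] by (simp add: X_def)
  next
    case (Suc j)
    then show ?case
      by (simp add: y_Suc homeo_less_iff del: thompson_seq.simps)
  qed
  then show ?thesis by (simp add: Suc del: thompson_seq.simps)
qed

text \<open>\<open>y (Suc (Suc k))\<close> is trivial up to \<open>X b = g (f b)\<close>, and
  \<open>f\<close> is trivial from there on.\<close>

lemma f_commute: "f \<circ> y (Suc (Suc k)) = y (Suc (Suc k)) \<circ> f"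
proof (rule homeo_commute_disjoint)
  fix x
  show "f x = x \<or> y (Suc (Suc k)) x = x"
  proof (cases "X b \<le> x")
    case True
    then show ?thesis using f(4) by (simp add: X_def)
  next
    case False
    then have "x \<le> (X ^^ Suc k) b" using X_pow_mono[of 1 "Suc k"] by simp
    then show ?thesis using y_Suc_fix by blast
  qed
qed (use f(1) in \<open>simp_all del: thompson_seq.simps\<close>)

text \<open>For \<open>i = 0\<close> this is the recursion. For \<open>i = 1\<close>, conjugation by
  \<open>g\<close> and by \<open>X = g \<circ> f\<close> agree on the later terms because these
  commute with \<open>f\<close>. Larger \<open>i\<close> reduce to \<open>i - 1\<close> by
  conjugating everything with \<open>X\<close>.\<close>

lemma y_rel: "i < j \<Longrightarrow> hinv (y i) \<circ> y j \<circ> y i = y (Suc j)"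
proof (induction i arbitrary: j)
  case 0
  then obtain k where "j = Suc k" by (cases j) auto
  then show ?case by (simp add: y_0 y_Suc fun_eq_iff del: thompson_seq.simps)
next
  case (Suc i)
  then obtain k where j: "j = Suc (Suc k)" by (metis Suc_lessE less_imp_Suc_add)
  show ?case
  proof (cases i)
    case 0
    have "f \<circ> y j \<circ> hinv f = y j"
      using f_commute[of k] f(1) by (simp add: j fun_eq_iff del: thompson_seq.simps)
    then have "g \<circ> y j \<circ> hinv g = X \<circ> y j \<circ> hinv X"
      using f g unfolding X_def hinv_comp[OF g(1) f(1)] by (metis comp_assoc)
    moreover have "hinv (y (Suc 0)) = g" "y (Suc 0) = hinv g"
      using g(1) by simp_all
    ultimately show ?thesis
      unfolding 0 j y_Suc[of "Suc k"] by (simp only:)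
  next
    case (Suc i')
    have "hinv (y i) \<circ> y (Suc k) \<circ> y i = y (Suc (Suc k))"
      using Suc.prems unfolding j by (intro Suc.IH) simp
    moreover have "X \<circ> hinv (y i) \<circ> hinv X \<circ> (X \<circ> y (Suc k) \<circ> hinv X) \<circ> (X \<circ> y i \<circ> hinv X)
        = X \<circ> (hinv (y i) \<circ> y (Suc k) \<circ> y i) \<circ> hinv X"
      unfolding fun_eq_iff comp_apply hinv_left[OF X_homeo] by simp
    ultimately show ?thesis
      unfolding j Suc y_Suc hinv_conj[OF y_homeo X_homeo] by (simp only:)
  qed
qed

lemma relations: "thompson_relations Homeo_plus y"
  by unfold_locales (use y_rel in \<open>simp_all del: thompson_seq.simps\<close>)

sublocale rel: thompson_relations Homeo_plus y
  by (rule relations)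

lemma pos_le: "rel.pos P x \<le> x"
proof (induction P)
  case (Cons j P)
  then show ?case using y_le[of j "rel.pos P x"] by (simp del: thompson_seq.simps)
qed simp

text \<open>All \<open>y k\<close> push points down, so a move is never undone. Letters above
  \<open>m\<close> are trivial up to \<open>(X ^^ m) b\<close>, while \<open>y m\<close> moves this
  point. Thus the action detects the least letter, as \<open>generated_iso_thompson_F\<close>
  requires.\<close>

lemma pos_moves_iff:
  assumes "\<forall>k\<in>set P. m \<le> k"
  shows "rel.pos P ((X ^^ m) b) < (X ^^ m) b \<longleftrightarrow> m \<in> set P"
  using assms
proof (induction P)
  case (Cons j P)
  show ?case
  proof (cases "m \<in> set P")
    case True
    then show ?thesis
      using Cons y_le[of j "rel.pos P ((X ^^ m) b)"] by (simp del: thompson_seq.simps)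
  next
    case False
    then have P: "rel.pos P ((X ^^ m) b) = (X ^^ m) b"
      using Cons pos_le[of P "(X ^^ m) b"] by auto
    show ?thesis
    proof (cases "j = m")
      case True
      then show ?thesis using P y_moves[of m] by (simp del: thompson_seq.simps)
    next
      case False
      then obtain k where "j = Suc k" "m \<le> k" using Cons.prems by (cases j) auto
      then have "y j ((X ^^ m) b) = (X ^^ m) b"
        using y_Suc_fix[of "(X ^^ m) b" k] X_pow_mono[of m k] by simp
      then show ?thesis using P False \<open>m \<notin> set P\<close> by (simp del: thompson_seq.simps)
    qed
  qed
qed simp

lemma generate_eq: "generate Homeo_plus (range y) = generate Homeo_plus {f, g}"
proof
  have S: "{f, g} \<subseteq> homeo" "range y \<subseteq> homeo" using f(1) g(1) by auto
  note closed = generate_closed_Homeo[OF S(1)]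
  have fg: "f \<in> generate Homeo_plus {f, g}" "g \<in> generate Homeo_plus {f, g}"
    by (auto intro: generate.incl)
  then have Xg: "X \<in> generate Homeo_plus {f, g}" unfolding X_def by (intro closed(2))
  have "y (Suc k) \<in> generate Homeo_plus {f, g}" for k
  proof (induction k)
    case 0
    show ?case using closed(3)[OF fg(2)] by simp
  next
    case (Suc k)
    then show ?case unfolding y_Suc by (intro closed(2,3) Xg)
  qed
  then have "y k \<in> generate Homeo_plus {f, g}" for k
    using closed(3)[OF Xg] by (cases k) (simp_all add: y_0 del: thompson_seq.simps)
  then show "generate Homeo_plus (range y) \<subseteq> generate Homeo_plus {f, g}"
    by (intro HP.generate_subgroup_incl HP.generate_is_subgroup S) auto
  note closed = generate_closed_Homeo[OF S(2)]
  have y: "y k \<in> generate Homeo_plus (range y)" for k by (auto intro: generate.incl)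
  have "g = hinv (y 1)" "f = y 1 \<circ> hinv (y 0)"
    using f(1) g(1) by (auto simp: fun_eq_iff homeo_comp)
  then have "{f, g} \<subseteq> generate Homeo_plus (range y)"
    using closed(2)[OF y[of 1] closed(3)[OF y[of 0]]] closed(3)[OF y[of 1]]
    by (simp del: thompson_seq.simps)
  then show "generate Homeo_plus {f, g} \<subseteq> generate Homeo_plus (range y)"
    by (intro HP.generate_subgroup_incl HP.generate_is_subgroup S)
qed

lemma iso_thompson_F: "subgroup_generated Homeo_plus {f, g} \<cong> thompson_F"
proof -
  have "subgroup_generated Homeo_plus (range y) \<cong> thompson_F"
  proof (rule generated_iso_thompson_F[OF relations])
    fix P Q m
    assume "rel.pos P = rel.pos Q" "m \<in> set P" "\<forall>k\<in>set P \<union> set Q. m \<le> k"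
    then show "m \<in> set Q"
      using pos_moves_iff[of P m] pos_moves_iff[of Q m] by auto
  qed
  moreover have "homeo \<inter> range y = range y" "homeo \<inter> {f, g} = {f, g}"
    using f(1) g(1) by auto
  ultimately show ?thesis
    by (simp add: subgroup_generated_def generate_eq)
qed

end

section \<open>Bump homeomorphisms\<close>

text \<open>Slope \<open>2\<close> on \<open>[a, b]\<close> and slope \<open>1/2\<close> on \<open>[b, 3 b - 2 a]\<close>.\<close>

definition bump :: "real \<Rightarrow> real \<Rightarrow> real \<Rightarrow> real" where
  "bump a b x = max x (min (2 * x - a) ((x + 3 * b - 2 * a) / 2))"

lemma bump_simps:
  assumes "a < b"
  shows "x \<le> a \<Longrightarrow> bump a b x = x"
    and "a \<le> x \<Longrightarrow> x \<le> b \<Longrightarrow> bump a b x = 2 * x - a"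
    and "b \<le> x \<Longrightarrow> x \<le> 3 * b - 2 * a \<Longrightarrow> bump a b x = (x + 3 * b - 2 * a) / 2"
    and "3 * b - 2 * a \<le> x \<Longrightarrow> bump a b x = x"
  using assms unfolding bump_def max_def min_def by (auto split: if_splits)

lemma bump_ge: "x \<le> bump a b x"
  by (simp add: bump_def)

lemma bump_gt_iff: "a < b \<Longrightarrow> x < bump a b x \<longleftrightarrow> a < x \<and> x < 3 * b - 2 * a"
  unfolding bump_def max_def min_def by (auto split: if_splits)

lemma bump_homeo:
  assumes "a < b"
  shows "bump a b \<in> homeo"
proof (rule homeoI)
  \<comment> \<open>The inverse of a maximum of increasing bijections is the minimum of their
    inverses, and vice versa.\<close>
  define h where "h y = min y (max ((y + a) / 2) (2 * y - 3 * b + 2 * a))" for y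
  show "continuous_on UNIV (bump a b)" "continuous_on UNIV h"
    unfolding bump_def[abs_def] h_def[abs_def] by (auto intro!: continuous_intros)
  show "strict_mono (bump a b)"
    unfolding strict_mono_def bump_def max_def min_def by auto
  show "bump a b (h x) = x" "h (bump a b x) = x" for x
    using assms unfolding h_def bump_def max_def min_def by (auto split: if_splits simp: field_simps)
qed

section \<open>Orbits of points\<close>

lemma generate_fix:
  assumes "S \<subseteq> homeo" "\<And>s. s \<in> S \<Longrightarrow> s x = x" "g \<in> generate Homeo_plus S"
  shows "g x = x"
  using assms(3,1) by (induction rule: generate_Homeo_induct) (auto simp: assms(2) hinv_fix_iff)

text \<open>Otherwise the infimum of the orbit lies in (a, L) and some \<open>s\<close> moves it up.
  An orbit point below the image of the infimum is then sent below the infimum by the inverse of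
  \<open>s\<close>.\<close>

lemma push_down:
  assumes S: "S \<subseteq> homeo"
    and move: "\<And>x. a < x \<Longrightarrow> x < L \<Longrightarrow> \<exists>s\<in>S. x < s x"
    and "a < x" "x < L" "a < y"
  shows "\<exists>g\<in>generate Homeo_plus S. g x < y"
proof (rule ccontr)
  assume "\<not> ?thesis"
  then have low: "y \<le> g x" if "g \<in> generate Homeo_plus S" for g
    using that by (auto simp: not_less)
  note closed = generate_closed_Homeo[OF S]
  define T where "T = (\<lambda>g. g x) ` generate Homeo_plus S"
  have T: "T \<noteq> {}" "bdd_below T"
    using closed(1) low by (auto simp: T_def bdd_below_def)
  have xT: "x \<in> T" unfolding T_def using closed(1) by (rule rev_image_eqI) simp
  have "y \<le> Inf T" using T low by (intro cInf_greatest) (auto simp: T_def)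
  moreover have "Inf T \<le> x" using xT T(2) by (rule cInf_lower)
  ultimately have "a < Inf T" "Inf T < L" using \<open>a < y\<close> \<open>x < L\<close> by linarith+
  then obtain s where s: "s \<in> S" "Inf T < s (Inf T)" using move by blast
  then obtain g where g: "g \<in> generate Homeo_plus S" "g x < s (Inf T)"
    using cInf_lessD[OF T(1), of "s (Inf T)"] by (auto simp: T_def)
  have "hinv s \<circ> g \<in> generate Homeo_plus S"
    using closed(2,3) g(1) s(1) by (auto intro: generate.incl)
  then have "hinv s (g x) \<in> T" unfolding T_def by (rule rev_image_eqI) simp
  then have "Inf T \<le> hinv s (g x)" using T(2) by (rule cInf_lower)
  then show False
    using g(2) s(1) S by (simp add: le_hinv_iff subset_iff)
qed

lemma push_up:
  assumes S: "S \<subseteq> homeo"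
    and move: "\<And>x. a < x \<Longrightarrow> x < L \<Longrightarrow> \<exists>s\<in>S. x < s x"
    and "a < x" "x < L" "y < L"
  shows "\<exists>g\<in>generate Homeo_plus S. y < g x"
proof (rule ccontr)
  assume "\<not> ?thesis"
  then have up: "g x \<le> y" if "g \<in> generate Homeo_plus S" for g
    using that by (auto simp: not_less)
  note closed = generate_closed_Homeo[OF S]
  define T where "T = (\<lambda>g. g x) ` generate Homeo_plus S"
  have T: "T \<noteq> {}" "bdd_above T"
    using closed(1) up by (auto simp: T_def bdd_above_def)
  have xT: "x \<in> T" unfolding T_def using closed(1) by (rule rev_image_eqI) simp
  have "Sup T \<le> y" using T up by (intro cSup_least) (auto simp: T_def)
  moreover have "x \<le> Sup T" using xT T(2) by (rule cSup_upper)
  ultimately have "a < Sup T" "Sup T < L" using \<open>a < x\<close> \<open>y < L\<close> by linarith+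
  then obtain s where s: "s \<in> S" "Sup T < s (Sup T)" using move by blast
  then have "hinv s (Sup T) < Sup T"
    using S by (simp add: hinv_less_iff subset_iff)
  then obtain g where g: "g \<in> generate Homeo_plus S" "hinv s (Sup T) < g x"
    using less_cSupD[OF T(1), of "hinv s (Sup T)"] by (auto simp: T_def)
  have "s \<circ> g \<in> generate Homeo_plus S"
    using closed(2) g(1) s(1) by (auto intro: generate.incl)
  then have "s (g x) \<in> T" unfolding T_def by (rule rev_image_eqI) simp
  then have "s (g x) \<le> Sup T" using T(2) by (rule cSup_upper)
  then show False
    using g(2) s(1) S by (simp add: hinv_less_iff subset_iff)
qed

text \<open>
  An interval missing \<open>b\<close> and its image \<open>2 b - a\<close> under the bump is doubled by one of the bump, its
  inverse and \<open>h\<close> and stays within \<open>[a, 3 b - 2 a]\<close>; so a sufficiently long iteration hits \<open>b\<close>.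
\<close>

lemma dense_orbit:
  assumes S: "S \<subseteq> homeo" and "a < b"
    and f: "bump a b \<in> generate Homeo_plus S"
    and h: "h \<in> generate Homeo_plus S" "\<And>x. b \<le> x \<Longrightarrow> x \<le> 2 * b - a \<Longrightarrow> h x = 2 * x - b"
    and "a \<le> u" "u < v" "v \<le> 3 * b - 2 * a"
  shows "\<exists>g\<in>generate Homeo_plus S. u < g b \<and> g b < v"
proof -
  note closed = generate_closed_Homeo[OF S]
  let ?f = "bump a b" and ?K = "generate Homeo_plus S"
  have fh: "?f \<in> homeo" using \<open>a < b\<close> by (rule bump_homeo)
  have inv_f: "hinv ?f x = 2 * x - 3 * b + 2 * a" if "2 * b - a \<le> x" "x \<le> 3 * b - 2 * a" for x
    using that \<open>a < b\<close> fh by (simp add: hinv_eq_iff bump_simps(3))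
  have pull: "\<exists>g\<in>?K. u < g b \<and> g b < v"
    if k: "k \<in> ?K" and ex: "\<exists>g\<in>?K. k u < g b \<and> g b < k v" for k u v
  proof -
    obtain g where g: "g \<in> ?K" "k u < g b" "g b < k v" using ex by blast
    then show ?thesis
      using closed(2)[OF closed(3)[OF k] g(1)] closed(4)[OF k]
      by (intro bexI[of _ "hinv k \<circ> g"]) (auto simp: less_hinv_iff hinv_less_iff)
  qed
  have main: "\<exists>g\<in>?K. u < g b \<and> g b < v"
    if "3 * b - 3 * a < (v - u) * 2 ^ m" "a \<le> u" "u < v" "v \<le> 3 * b - 2 * a" for m u v
    using that
  proof (induction m arbitrary: u v)
    \<comment> \<open>The interval would be longer than [a, 3 b - 2 a], which contains it.\<close>
    case 0
    then show ?case by simp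
  next
    case (Suc m)
    \<comment> \<open>All three expanding maps have the form 2 x - w, with w = a, b and 3 b - 2 a,
      so one estimate serves them all.\<close>
    have long: "3 * b - 3 * a < (2 * v - w - (2 * u - w)) * 2 ^ m" for w
      using Suc.prems(1) by (simp add: algebra_simps)
    consider "u < b \<and> b < v" | "u < 2 * b - a \<and> 2 * b - a < v" | "v \<le> b"
      | "b \<le> u \<and> v \<le> 2 * b - a" | "2 * b - a \<le> u" by linarith
    then show ?case
    proof cases
      case 1
      then show ?thesis using closed(1) by (intro bexI[of _ id]) auto
    next
      case 2
      then show ?thesis using f \<open>a < b\<close> by (intro bexI[of _ ?f]) (auto simp: bump_simps(2))
    next
      case 3
      then have "?f u = 2 * u - a" "?f v = 2 * v - a"
        using Suc.prems(2-4) \<open>a < b\<close> by (auto intro!: bump_simps(2))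
      then have "\<exists>g\<in>?K. ?f u < g b \<and> g b < ?f v"
        using Suc.prems(2-4) 3 \<open>a < b\<close> by (simp only:) (intro Suc.IH long; linarith)
      then show ?thesis by (rule pull[OF f])
    next
      case 4
      then have "h u = 2 * u - b" "h v = 2 * v - b"
        using Suc.prems(2-4) by (auto intro!: h(2))
      then have "\<exists>g\<in>?K. h u < g b \<and> g b < h v"
        using Suc.prems(2-4) 4 \<open>a < b\<close> by (simp only:) (intro Suc.IH long; linarith)
      then show ?thesis by (rule pull[OF h(1)])
    next
      case 5
      then have "hinv ?f u = 2 * u - (3 * b - 2 * a)" "hinv ?f v = 2 * v - (3 * b - 2 * a)"
        using Suc.prems(2-4) inv_f[of u] inv_f[of v] by linarith+
      then have "\<exists>g\<in>?K. hinv ?f u < g b \<and> g b < hinv ?f v"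
        using Suc.prems(2-4) 5 \<open>a < b\<close> by (simp only:) (intro Suc.IH long; linarith)
      then show ?thesis by (rule pull[OF closed(3)[OF f]])
    qed
  qed
  obtain m :: nat where "(3 * b - 3 * a) / (v - u) < 2 ^ m"
    using real_arch_pow[of 2 "(3 * b - 3 * a) / (v - u)"] by auto
  then have "3 * b - 3 * a < (v - u) * 2 ^ m"
    using \<open>u < v\<close> by (simp add: field_simps)
  then show ?thesis using main assms by blast
qed

section \<open>Chains of bumps\<close>

text \<open>Consecutive left ends serve as start and break point of a bump. \<open>A_gap\<close>
  keeps the supports of bumps that are not neighbours disjoint.\<close>

locale bump_chain =
  fixes A :: "nat \<Rightarrow> real" and n :: nat
  assumes A_less: "1 \<le> i \<Longrightarrow> A i < A (Suc i)"
    and A_gap: "1 \<le> i \<Longrightarrow> 3 * A (Suc i) - 2 * A i \<le> A (Suc (Suc i))"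
    and n: "2 \<le> n"
begin

definition f :: "nat \<Rightarrow> real \<Rightarrow> real" where
  "f i = bump (A i) (A (Suc i))"

definition C :: "nat \<Rightarrow> real" where
  "C i = 3 * A (Suc i) - 2 * A i"

lemma C_le: "1 \<le> i \<Longrightarrow> C i \<le> A (Suc (Suc i))"
  and less_C: "1 \<le> i \<Longrightarrow> A (Suc i) < C i"
  using A_gap[of i] A_less[of i] by (simp_all add: C_def)

lemma A_mono: "1 \<le> i \<Longrightarrow> i \<le> j \<Longrightarrow> A i \<le> A j"
  using lift_Suc_mono_le[of "\<lambda>k. A (Suc k)" "i - 1" "j - 1"] A_less by (auto simp: less_imp_le)

lemma C_less: "1 \<le> i \<Longrightarrow> i < j \<Longrightarrow> C i < C j"
  using C_le[of i] less_C[of j] A_mono[of "Suc (Suc i)" "Suc j"] by simp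

lemma f_homeo [simp]: "1 \<le> i \<Longrightarrow> f i \<in> homeo"
  unfolding f_def using A_less by (rule bump_homeo)

lemma f_ge: "x \<le> f i x"
  by (simp add: f_def bump_ge)

lemma f_gt_iff: "1 \<le> i \<Longrightarrow> x < f i x \<longleftrightarrow> A i < x \<and> x < C i"
  using bump_gt_iff[OF A_less[of i], of x] by (simp add: f_def C_def)

lemma f_fix: "1 \<le> i \<Longrightarrow> x \<le> A i \<or> C i \<le> x \<Longrightarrow> f i x = x"
  using f_gt_iff[of i x] f_ge[of x i] by auto

lemma f_left: "1 \<le> i \<Longrightarrow> A i \<le> x \<Longrightarrow> x \<le> A (Suc i) \<Longrightarrow> f i x = 2 * x - A i"
  using A_less by (simp add: f_def bump_simps(2))

lemma f_right: "1 \<le> i \<Longrightarrow> A (Suc i) \<le> x \<Longrightarrow> x \<le> C i \<Longrightarrow> f i x = (x + C i) / 2"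
  using A_less by (simp add: f_def C_def bump_simps(3))

text \<open>\<open>A_gap\<close> keeps the range below the break point of \<open>f (Suc i)\<close>.
  In \<open>contract\<close> this makes \<open>f 2\<close> the doubling map that
  \<open>dense_orbit\<close> asks for.\<close>

lemma f_Suc_left: "1 \<le> i \<Longrightarrow> A (Suc i) \<le> x \<Longrightarrow> x \<le> 2 * A (Suc i) - A i \<Longrightarrow> f (Suc i) x = 2 * x - A (Suc i)"
  using C_le[of i] A_less[of i] by (intro f_left) (auto simp: C_def)

text \<open>This ties neighbouring bumps together as \<open>two_chain\<close> demands: the support
  of \<open>f i\<close> ends exactly where the composite sends \<open>A (Suc i)\<close>.\<close>

lemma f_f: "1 \<le> i \<Longrightarrow> f (Suc i) (f i (A (Suc i))) = C i"
  using f_Suc_left[of i "2 * A (Suc i) - A i"] A_less[of i] by (simp add: f_left C_def)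

lemma supp_f:
  assumes "1 \<le> i"
  shows "supp (f i) = {A i<..<C i}"
proof -
  have "f i x \<noteq> x \<longleftrightarrow> x \<in> {A i<..<C i}" for x
    using f_gt_iff[OF assms, of x] f_ge[of x i] by auto
  then show ?thesis unfolding supp_def by blast
qed

lemma two_chain_f:
  assumes "1 \<le> i"
  shows "two_chain (f i) (f (Suc i)) (A (Suc i))"
proof
  show "A (Suc i) < f i (A (Suc i))" "f (Suc i) (f i (A (Suc i))) < f (Suc i) (f (Suc i) (f i (A (Suc i))))"
    using assms A_less[of i] less_C[of i] C_less[of i "Suc i"]
    by (simp_all add: f_f f_gt_iff)
next
  fix x
  show "x \<le> f i x" "x \<le> f (Suc i) x" by (fact f_ge)+
  show "f i \<in> homeo" "f (Suc i) \<in> homeo" using assms by simp_all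
  show "f (Suc i) x = x" if "x \<le> A (Suc i)" using that assms by (simp add: f_fix)
  show "f i x = x" if "f (Suc i) (f i (A (Suc i))) \<le> x"
    using that assms by (simp add: f_f f_fix)
qed

definition gens :: "(real \<Rightarrow> real) set" where
  "gens = f ` {1..n}"

lemma gens_homeo: "gens \<subseteq> homeo"
  by (auto simp: gens_def)

lemma f_gens: "1 \<le> i \<Longrightarrow> i \<le> n \<Longrightarrow> f i \<in> gens"
  by (simp add: gens_def)

lemma left_endpoint_interval: "a < c \<Longrightarrow> left_endpoint {a<..<c} = ereal a"
  unfolding left_endpoint_def
  using ereal_Inf'[of "{a<..<c}"] by (simp add: cInf_greaterThanLessThan image_def)

lemma chain_group: "chain_group n (subgroup_generated Homeo_plus gens)"
  unfolding chain_group_def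
proof (intro conjI exI[of _ f])
  have less: "A i < C i" if "1 \<le> i" for i
    using A_less[OF that] less_C[OF that] by simp
  show "chain_of_intervals n (\<lambda>i. supp (f i))"
    unfolding chain_of_intervals_def
  proof (intro conjI ballI impI)
    fix i assume "i \<in> {1..n}"
    then show "supp (f i) \<noteq> {}" "open (supp (f i))" "is_interval (supp (f i))"
      using less[of i] by (auto simp: supp_f is_interval_oo)
  next
    fix i k assume ik: "i \<in> {1..n}" "k \<in> {1..n}" "\<bar>int i - int k\<bar> > 1"
    have disj: "supp (f i) \<inter> supp (f k) = {}" if "1 \<le> i" "Suc i < k" for i k
      using that C_le[of i] A_mono[of "Suc (Suc i)" k] by (auto simp: supp_f)
    have "Suc i < k \<or> Suc k < i" using ik by auto
    then show "supp (f i) \<inter> supp (f k) = {}" using disj[of i k] disj[of k i] ik by auto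
  next
    fix i assume i: "i \<in> {1..<n}"
    then have A: "A i < A (Suc i)" "A (Suc i) < C i" "C i < C (Suc i)"
      using A_less less_C C_less by auto
    then have int: "supp (f i) \<inter> supp (f (Suc i)) = {A (Suc i)<..<C i}"
      using i by (auto simp: supp_f)
    show "is_interval (supp (f i) \<inter> supp (f (Suc i)))" "supp (f i) \<inter> supp (f (Suc i)) \<noteq> {}"
      unfolding int using A by (auto simp: is_interval_oo)
    have "A (Suc i) \<in> supp (f i)" "C i \<in> supp (f (Suc i))"
      using i A by (auto simp: supp_f)
    moreover have "A (Suc i) \<notin> supp (f (Suc i))" "C i \<notin> supp (f i)"
      using i by (auto simp: supp_f)
    ultimately show "supp (f i) \<inter> supp (f (Suc i)) \<subset> supp (f i)"
      "supp (f i) \<inter> supp (f (Suc i)) \<subset> supp (f (Suc i))" by blast+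
  qed
  show "\<forall>i\<in>{1..<n}. left_endpoint (supp (f i)) < left_endpoint (supp (f (Suc i)))"
    using less A_less by (simp add: supp_f left_endpoint_interval)
  show "\<forall>i\<in>{1..<n}. subgroup_generated Homeo_plus {f i, f (Suc i)} \<cong> thompson_F"
    using two_chain.iso_thompson_F[OF two_chain_f] by auto
next
  show "\<forall>i\<in>{1..n}. \<forall>t. t \<le> f i t" using f_ge by blast
  show "\<forall>i\<in>{1..n}. f i \<in> homeo" by simp
  show "subgroup_generated Homeo_plus gens = subgroup_generated Homeo_plus (f ` {1..n})"
    by (simp add: gens_def)
qed (rule n)

section \<open>The contraction property of a chain\<close>

lemma cover:
  assumes "A 1 < x" "x < C m" "1 \<le> m"
  shows "\<exists>i\<in>{1..m}. A i < x \<and> x < C i"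
  using assms(3,2)
proof (induction m rule: dec_induct)
  case base
  then show ?case using assms by auto
next
  case (step m)
  show ?case
  proof (cases "x < C m")
    case True
    then show ?thesis using step.IH by force
  next
    case False
    then have "A (Suc m) < x" using less_C[of m] step by simp
    then show ?thesis using step.prems by (intro bexI[of _ "Suc m"]) auto
  qed
qed

lemma gens_fix: "s \<in> gens \<Longrightarrow> x \<le> A 1 \<or> C n \<le> x \<Longrightarrow> s x = x"
proof -
  have "C i \<le> C n" if "1 \<le> i" "i \<le> n" for i
    using C_less[of i n] that by (cases "i = n") auto
  then show "s \<in> gens \<Longrightarrow> x \<le> A 1 \<or> C n \<le> x \<Longrightarrow> s x = x"
    using A_mono[of 1] by (force simp: gens_def intro!: f_fix)
qed

lemma gens_move: "A 1 < x \<Longrightarrow> x < C n \<Longrightarrow> \<exists>s\<in>gens. x < s x"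
proof -
  assume "A 1 < x" "x < C n"
  then obtain i where i: "1 \<le> i" "i \<le> n" "A i < x" "x < C i" using cover[of x n] n by auto
  then show ?thesis using f_gt_iff[of i x] f_gens[of i] by auto
qed

lemma generate_inside:
  assumes "1 \<le> i" "g \<in> generate Homeo_plus {f i}" "A i < x" "x < C i"
  shows "A i < g x" "g x < C i"
proof -
  have "g (A i) = A i" "g (C i) = C i"
    using generate_fix[OF _ _ assms(2)] assms(1) f_fix[of i "A i"] f_fix[of i "C i"] by simp_all
  moreover have "g \<in> homeo"
    using generate_closed_Homeo(4)[of "{f i}" g] assms by simp
  ultimately show "A i < g x" "g x < C i"
    using assms(3,4) homeo_less_iff by metis+
qed

text \<open>By density some \<open>w\<close> takes \<open>A 2\<close> into (u, v), so it suffices to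
  bring [p, q] close to \<open>A 2\<close> from above. The interval is first moved below
  \<open>C 1\<close>, then raised by powers of \<open>f 1\<close> until its left end exceeds
  \<open>A 2\<close>, then lowered by powers of \<open>f 2\<close>, which cannot cross
  \<open>A 2\<close>, until \<open>w\<close> carries it into (u, v).\<close>

lemma contract:
  assumes "A 1 < p" "p \<le> q" "q < C n" "A 1 \<le> u" "u < v" "v \<le> C n"
  shows "\<exists>g\<in>generate Homeo_plus gens. u < g p \<and> g q < v"
proof -
  let ?K = "generate Homeo_plus gens"
  note closed = generate_closed_Homeo[OF gens_homeo]
  have f12: "f 1 \<in> gens" "f 2 \<in> gens" using n by (auto intro: f_gens)
  then have sub: "generate Homeo_plus {f 1} \<subseteq> ?K" "generate Homeo_plus {f 2} \<subseteq> ?K"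
    using HP.mono_generate[of "{f 1}" gens] HP.mono_generate[of "{f 2}" gens] by auto
  have A12: "A 1 < A 2" "A 2 < C 1" "C 1 < C 2" "A 2 < A 3"
    using A_less[of 1] less_C[of 1] C_less[of 1 2] A_less[of 2] by (auto simp: numeral_2_eq_2 numeral_3_eq_3)
  have down: "\<exists>g\<in>?K. g x < C 1" if "A 1 < x" "x < C n" for x
    using push_down[OF gens_homeo, of "A 1" "C n" x "C 1"] gens_move that A12 by auto
  have fix1: "g (A 1) = A 1" if "g \<in> ?K" for g
    using generate_fix[OF gens_homeo _ that, of "A 1"] gens_fix[of _ "A 1"] by blast
  have "\<exists>w\<in>?K. u < w (A 2) \<and> w (A 2) < v"
  proof -
    \<comment> \<open>\<open>v\<close> may be \<open>C n\<close>, which every element fixes; the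
      midpoint can always be brought below \<open>C 1\<close>, where \<open>dense_orbit\<close>
      applies.\<close>
    define v' where "v' = (u + v) / 2"
    have v': "u < v'" "v' < v" using assms by (auto simp: v'_def)
    then obtain g where g: "g \<in> ?K" "g v' < C 1" using down[of v'] assms by auto
    have "A 1 \<le> g u" "g u < g v'"
      using homeo_le_iff[OF closed(4)[OF g(1)], of "A 1" u] homeo_less_iff[OF closed(4)[OF g(1)], of u v']
        fix1[OF g(1)] assms v' by auto
    moreover have "bump (A 1) (A 2) \<in> ?K" "f 2 \<in> ?K"
      using f12 by (auto simp: f_def numeral_2_eq_2 intro: generate.incl)
    moreover have "f 2 x = 2 * x - A 2" if "A 2 \<le> x" "x \<le> 2 * A 2 - A 1" for x
      using f_Suc_left[of 1 x] that by (simp add: numeral_2_eq_2)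
    ultimately obtain k where k: "k \<in> ?K" "g u < k (A 2)" "k (A 2) < g v'"
      using dense_orbit[OF gens_homeo A12(1), of "f 2" "g u" "g v'"] g(2)
      by (auto simp: C_def numeral_2_eq_2)
    then show ?thesis
      using closed(2)[OF closed(3)[OF g(1)] k(1)] closed(4)[OF g(1)] v'
      by (intro bexI[of _ "hinv g \<circ> k"]) (auto simp: less_hinv_iff hinv_less_iff homeo_less_iff intro: less_trans)
  qed
  then obtain w where w: "w \<in> ?K" "u < w (A 2)" "w (A 2) < v" by blast
  obtain g1 where g1: "g1 \<in> ?K" "g1 q < C 1" using down[of q] assms by auto
  have p1: "A 1 < g1 p" "g1 p \<le> g1 q"
    using homeo_less_iff[OF closed(4)[OF g1(1)], of "A 1" p] homeo_le_iff[OF closed(4)[OF g1(1)], of p q]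
      fix1[OF g1(1)] assms by auto
  obtain g2 where g2: "g2 \<in> generate Homeo_plus {f 1}" "A 2 < g2 (g1 p)"
    using push_up[of "{f 1}" "A 1" "C 1" "g1 p" "A 2"] f_gt_iff[of 1] p1 g1(2) A12 by auto
  have q2: "g2 (g1 q) < C 1"
    using generate_inside(2)[OF _ g2(1), of "g1 q"] p1 g1(2) by simp
  have le2: "g2 (g1 p) \<le> g2 (g1 q)"
    using generate_closed_Homeo(4)[OF _ g2(1)] p1 by (simp add: homeo_le_iff)
  have "A 2 < hinv w v" using w closed(4) by (simp add: less_hinv_iff)
  then obtain g3 where g3: "g3 \<in> generate Homeo_plus {f 2}" "g3 (g2 (g1 q)) < hinv w v"
    using push_down[of "{f 2}" "A 2" "C 2" "g2 (g1 q)" "hinv w v"] f_gt_iff[of 2]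
      g2(2) le2 q2 A12 by auto
  have p3: "A 2 < g3 (g2 (g1 p))"
    using generate_inside(1)[OF _ g3(1), of "g2 (g1 p)"] g2(2) le2 q2 A12 by simp
  have "w \<circ> (g3 \<circ> (g2 \<circ> g1)) \<in> ?K"
    using w(1) g1(1) g2(1) g3(1) sub by (intro closed(2)) auto
  moreover have "u < w (g3 (g2 (g1 p)))"
    using w p3 homeo_less_iff[OF closed(4)[OF w(1)]] by (meson less_trans)
  moreover have "w (g3 (g2 (g1 q))) < v"
    using g3(2) w closed(4) by (simp add: less_hinv_iff)
  ultimately show ?thesis
    by (intro bexI[of _ "w \<circ> (g3 \<circ> (g2 \<circ> g1))"]) auto
qed

lemma right_trivial:
  assumes "1 \<le> i" "i < n"
  shows "\<exists>r<C n. \<forall>x\<ge>r. f i x = x"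
proof -
  have "\<forall>x\<ge>C i. f i x = x" using f_fix[OF assms(1)] by blast
  then show ?thesis using C_less[OF assms] by blast
qed

lemma left_trivial:
  assumes "1 < i"
  shows "\<exists>l>A 1. \<forall>x\<le>l. f i x = x"
proof -
  have "\<forall>x\<le>A i. f i x = x" using f_fix[of i] assms by auto
  moreover have "A 1 < A i" using A_less[of 1] A_mono[of 2 i] assms by (simp add: numeral_2_eq_2)
  ultimately show ?thesis by blast
qed

sublocale contracting_group gens "A 1" "C n"
proof
  fix s assume "s \<in> gens"
  then obtain i where i: "1 \<le> i" "i \<le> n" "s = f i" by (auto simp: gens_def)
  show "\<exists>r>0. \<exists>e>A 1. \<forall>x\<in>{A 1..e}. s x = A 1 + r * (x - A 1)"
  proof (cases "i = 1")
    case True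
    then show ?thesis
      using i A_less[of 1] f_left[of 1] by (intro exI[of _ 2] exI[of _ "A 2"] conjI) (auto simp: numeral_2_eq_2)
  next
    case False
    then obtain l where "l > A 1" "\<forall>x\<le>l. s x = x" using left_trivial[of i] i by auto
    then show ?thesis by (intro exI[of _ 1] exI[of _ l] conjI) auto
  qed
  show "\<exists>r>0. \<exists>e<C n. \<forall>x\<in>{e..C n}. s x = C n - r * (C n - x)"
  proof (cases "i = n")
    case True
    then show ?thesis
      using i less_C[of n] f_right[of n] by (intro exI[of _ "1/2"] exI[of _ "A (Suc n)"] conjI) (auto simp: field_simps)
  next
    case False
    then obtain r where "r < C n" "\<forall>x\<ge>r. s x = x" using right_trivial[of i] i by auto
    then show ?thesis by (intro exI[of _ 1] exI[of _ r] conjI) auto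
  qed
  show "(\<exists>r<C n. \<forall>x\<ge>r. s x = x) \<or> (\<exists>l>A 1. \<forall>x\<le>l. s x = x)"
    using right_trivial[of i] left_trivial[of i] i n by (cases "i = n") auto
  fix t assume "t \<in> gens" "s \<noteq> t"
  then obtain j where j: "1 \<le> j" "j \<le> n" "t = f j" by (auto simp: gens_def)
  then have "i \<noteq> j" using i \<open>s \<noteq> t\<close> by auto
  show "(\<exists>r<C n. \<forall>x\<ge>r. s x = x) \<and> (\<exists>l>A 1. \<forall>x\<le>l. t x = x) \<or>
        (\<exists>r<C n. \<forall>x\<ge>r. t x = x) \<and> (\<exists>l>A 1. \<forall>x\<le>l. s x = x)"
  proof (cases "i < j")
    case True
    then show ?thesis using right_trivial[of i] left_trivial[of j] i j by auto
  next
    case False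
    then show ?thesis using right_trivial[of j] left_trivial[of i] i j \<open>i \<noteq> j\<close> by auto
  qed
next
  \<comment> \<open>The first two generators are told apart from a commuting pair at the point
    \<open>A 2\<close>: one order of composition gives \<open>f 1 (A 2)\<close>, the other
    \<open>C 1\<close>.\<close>
  have "f 1 (A 2) < C 1"
    using f_left[of 1 "A 2"] A_less[of 1] by (simp add: C_def numeral_2_eq_2)
  moreover have "f 2 (A 2) = A 2" by (rule f_fix) auto
  moreover have "f 2 (f 1 (A 2)) = C 1" using f_f[of 1] by (simp add: numeral_2_eq_2)
  ultimately have "(f 1 \<circ> f 2) (A 2) \<noteq> (f 2 \<circ> f 1) (A 2)" by simp
  then have "f 1 \<circ> f 2 \<noteq> f 2 \<circ> f 1" by metis
  then show "\<exists>s\<in>gens. \<exists>t\<in>gens. s \<circ> t \<noteq> t \<circ> s"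
    using f_gens[of 1] f_gens[of 2] n by auto
qed (fact gens_homeo gens_fix contract)+

end

section \<open>Countability\<close>

lemma (in group) countable_generate:
  assumes "countable S" "S \<subseteq> carrier G"
  shows "countable (generate G S)"
proof -
  have S: "\<And>s. s \<in> S \<Longrightarrow> s \<in> carrier G" using assms(2) by auto
  have "\<exists>w\<in>words S. h = eval_word G (\<lambda>x. x) w" if "h \<in> generate G S" for h
    using that
  proof (induction rule: generate.induct)
    case one
    show ?case by (intro bexI[of _ "[]"]) auto
  next
    case (incl h)
    then show ?case using S by (intro bexI[of _ "[(h, True)]"]) auto
  next
    case (inv h)
    then show ?case using S by (intro bexI[of _ "[(h, False)]"]) auto
  next
    case (eng h k)
    then obtain u v where "u \<in> words S" "v \<in> words S" "h = eval_word G (\<lambda>x. x) u" "k = eval_word G (\<lambda>x. x) v"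
      by blast
    then show ?case
      using eval_word_append[of S "\<lambda>x. x" u v] S by (intro bexI[of _ "u @ v"]) auto
  qed
  then have "generate G S \<subseteq> eval_word G (\<lambda>x. x) ` words S" by blast
  moreover have "countable (words S)"
    using assms(1) unfolding words_def by (intro countable_lists countable_SIGMA) auto
  ultimately show ?thesis by (meson countable_image countable_subset)
qed

lemma commutator_subgroup_iso:
  assumes "group G" "group H" "G \<cong> H"
  shows "commutator_subgroup G \<cong> commutator_subgroup H"
proof -
  obtain h where h: "h \<in> iso G H" using assms(3) by (auto simp: is_iso_def)
  then interpret h: group_hom G H h
    using assms by (simp add: group_hom_def group_hom_axioms_def iso_def)
  have bij: "inj_on h (carrier G)" "h ` carrier G = carrier H"
    using h by (auto simp: iso_def bij_betw_def)
  have sub: "derived G (carrier G) \<subseteq> carrier G"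
    by (rule h.G.derived_in_carrier) simp
  have img: "h ` derived G (carrier G) = derived H (carrier H)"
    using h.derived_img[of "carrier G"] bij by simp
  have "h \<in> iso (commutator_subgroup G) (commutator_subgroup H)"
    unfolding iso_def hom_def commutator_subgroup_def bij_betw_def
    using img inj_on_subset[OF bij(1) sub] sub h.hom_mult by (auto simp: subset_iff)
  then show ?thesis by (auto simp: is_iso_def)
qed

section \<open>An uncountable family of chain groups\<close>

text \<open>With powers of two \<open>A_gap\<close> is an equality from index 2 on; at index 1 it
  reads 12 - 2 a \<le> 8.\<close>

definition left_points :: "real \<Rightarrow> nat \<Rightarrow> real" where
  "left_points a i = (if i \<le> 1 then a else 2 ^ i)"

definition z_elt :: "real \<Rightarrow> real" where
  "z_elt = HP.commutator (bump 4 8) (bump 8 16)"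

text \<open>The first bump has slope 2 at its left end, so it is not in \<open>D\<close>. In this
  commutator the conjugate of its inverse by \<open>bump 4 8\<close> reaches furthest to the right,
  up to \<open>bump 4 8 (12 - 2 * a)\<close>; this point encodes \<open>a\<close>.\<close>

definition x_elt :: "real \<Rightarrow> real \<Rightarrow> real" where
  "x_elt a = HP.commutator (bump a 4) (bump 4 8)"

lemma bumps_homeo [simp]: "bump 4 8 \<in> homeo" "bump 8 16 \<in> homeo" "a < 4 \<Longrightarrow> bump a 4 \<in> homeo"
  by (auto intro: bump_homeo)

lemma z_homeo [simp]: "z_elt \<in> homeo"
  by (simp add: z_elt_def)

lemma z_left: "x \<le> 8 \<Longrightarrow> z_elt x = x"
proof -
  assume x: "x \<le> 8"
  have "hinv (bump 8 16) x = x" using x by (simp add: hinv_fix_iff bump_simps)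
  moreover have "hinv (bump 4 8) x \<le> 8" using x bump_ge[of 8 4 8] by (simp add: hinv_le_iff)
  ultimately show ?thesis by (simp add: z_elt_def HP.commutator_def bump_simps(1))
qed

text \<open>The inverse bumps take 16 to 12 and then 12 to 8. So points up to 16 have come down to
  where \<open>bump 8 16\<close> is trivial, and the two occurrences of \<open>bump 4 8\<close>
  cancel.\<close>

lemma z_mid: "8 \<le> x \<Longrightarrow> x \<le> 16 \<Longrightarrow> z_elt x = hinv (bump 8 16) x"
proof -
  assume x: "8 \<le> x" "x \<le> 16"
  have "bump 8 16 12 = 16" "bump 4 8 8 = 12" by (simp_all add: bump_simps(2))
  then have "hinv (bump 8 16) x \<le> bump 4 8 8" using x by (simp add: hinv_le_iff)
  then have "hinv (bump 4 8) (hinv (bump 8 16) x) \<le> 8" by (simp add: hinv_le_iff)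
  then show ?thesis by (simp add: z_elt_def HP.commutator_def bump_simps(1))
qed

lemma z_right: "24 \<le> x \<Longrightarrow> z_elt x = x"
proof -
  assume x: "24 \<le> x"
  have "bump 8 16 16 = 24" by (simp add: bump_simps(2))
  then have "16 \<le> hinv (bump 8 16) x" using x by (simp add: le_hinv_iff)
  then have "hinv (bump 4 8) (hinv (bump 8 16) x) = hinv (bump 8 16) x"
    by (simp add: hinv_fix_iff bump_simps(4))
  then show ?thesis using x by (simp add: z_elt_def HP.commutator_def bump_simps(4))
qed

text \<open>This is the doubling about 8 that \<open>dense_orbit\<close> needs for the bump from 4
  with break point 8, supplied by an element of \<open>D\<close>.\<close>

lemma hinv_z: "8 \<le> x \<Longrightarrow> x \<le> 12 \<Longrightarrow> hinv z_elt x = 2 * x - 8"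
proof -
  assume x: "8 \<le> x" "x \<le> 12"
  then have b: "bump 8 16 x = 2 * x - 8" by (simp add: bump_simps(2))
  then have "z_elt (2 * x - 8) = hinv (bump 8 16) (bump 8 16 x)" using x z_mid[of "2 * x - 8"] by simp
  then show ?thesis by (simp add: hinv_eq_iff)
qed

lemma z_less:
  assumes "8 < x" "x \<le> 16"
  shows "z_elt x < x"
  using assms z_mid[of x] bump_gt_iff[of 8 16 x] by (simp add: hinv_less_iff)

lemma x_right:
  assumes "a < 4" "bump 4 8 (12 - 2 * a) \<le> x"
  shows "x_elt a x = x"
proof -
  have le: "12 - 2 * a \<le> hinv (bump 4 8) x" using assms(2) by (simp add: le_hinv_iff)
  then have "hinv (bump a 4) (hinv (bump 4 8) x) = hinv (bump 4 8) x"
    using assms(1) by (simp add: hinv_fix_iff bump_simps(4))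
  moreover have "12 - 2 * a \<le> x" using assms(2) bump_ge[of "12 - 2 * a" 4 8] by simp
  ultimately show ?thesis using assms(1) by (simp add: x_elt_def HP.commutator_def bump_simps(4))
qed

text \<open>The conjugated inverse of the first bump moves \<open>x\<close> down. The remaining
  factor \<open>bump a 4\<close> cannot undo this: it is trivial from 12 - 2 a on and keeps smaller
  points below 12 - 2 a.\<close>

lemma x_less:
  assumes "a < 4" "12 - 2 * a \<le> x" "x < bump 4 8 (12 - 2 * a)"
  shows "x_elt a x < x"
proof -
  define y where "y = hinv (bump 4 8) x"
  have "bump 4 8 4 = 4" by (simp add: bump_simps)
  then have "4 < y" using assms by (simp add: y_def less_hinv_iff)
  moreover have "y < 12 - 2 * a" using assms by (simp add: y_def hinv_less_iff)
  ultimately have "hinv (bump a 4) y < y"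
    using assms bump_gt_iff[of a 4 y] by (simp add: hinv_less_iff)
  then have q: "bump 4 8 (hinv (bump a 4) y) < x"
    using homeo_less_iff[of "bump 4 8" "hinv (bump a 4) y" y] by (simp add: y_def)
  let ?q = "bump 4 8 (hinv (bump a 4) y)"
  have "bump a 4 ?q < x"
  proof (cases "12 - 2 * a \<le> ?q")
    case True
    then show ?thesis using q assms by (simp add: bump_simps(4))
  next
    case False
    then have "bump a 4 ?q < bump a 4 (12 - 2 * a)" using assms by (simp add: homeo_less_iff)
    also have "\<dots> = 12 - 2 * a" using assms by (simp add: bump_simps(4))
    finally show ?thesis using assms by simp
  qed
  then show ?thesis by (simp add: x_elt_def HP.commutator_def y_def)
qed

lemma dense_orbit_z:
  assumes "4 \<le> u" "u < v" "v \<le> 16"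
  shows "\<exists>g\<in>generate Homeo_plus {bump 4 8, z_elt}. u < g 8 \<and> g 8 < v"
proof (rule dense_orbit)
  show "hinv z_elt \<in> generate Homeo_plus {bump 4 8, z_elt}"
    by (rule generate.inv) simp
  show "bump 4 8 \<in> generate Homeo_plus {bump 4 8, z_elt}"
    by (rule generate.incl) simp
qed (use assms hinv_z in auto)

locale dyadic_chain =
  fixes n :: nat and a :: real
  assumes n3: "3 \<le> n" and a: "2 < a" "a < 4"
begin

sublocale bump_chain "left_points a" n
proof
  fix i :: nat assume "1 \<le> i"
  then consider "i = 1" | "2 \<le> i" by linarith
  note cases = this
  show "left_points a i < left_points a (Suc i)"
    using cases by cases (use a in \<open>auto simp: left_points_def\<close>)
  show "3 * left_points a (Suc i) - 2 * left_points a i \<le> left_points a (Suc (Suc i))"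
    using cases by cases (use a in \<open>auto simp: left_points_def\<close>)
qed (use n3 in simp)

lemma f_123: "f 1 = bump a 4" "f 2 = bump 4 8" "f 3 = bump 8 16"
  by (simp_all add: f_def left_points_def)

lemma f_K: "bump a 4 \<in> K" "bump 4 8 \<in> K" "bump 8 16 \<in> K"
  using f_gens[of 1] f_gens[of 2] f_gens[of 3] n3 unfolding f_123 K_def by (auto intro: generate.incl)

lemma x_D: "x_elt a \<in> D" and z_D: "z_elt \<in> D"
  unfolding x_elt_def z_elt_def using f_K by (auto intro: commutator_D)

text \<open>\<open>bump 4 8\<close> is only known to lie in \<open>K\<close>; \<open>approx\<close>
  provides this substitute in \<open>D\<close>. The ends of [4, 24] are fixed by
  \<open>bump 4 8\<close> and by \<open>z_elt\<close>, so words in these two can be compared on that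
  interval.\<close>

definition t_elt :: "real \<Rightarrow> real" where
  "t_elt = (SOME t. t \<in> D \<and> (\<forall>x. 4 \<le> x \<and> x \<le> 24 \<longrightarrow> t x = bump 4 8 x))"

lemma t_elt: "t_elt \<in> D" "4 \<le> x \<Longrightarrow> x \<le> 24 \<Longrightarrow> t_elt x = bump 4 8 x"
proof -
  have "C 3 \<le> C n" using C_less[of 3 n] n3 by (cases "n = 3") auto
  then have "24 < C n" by (simp add: C_def left_points_def)
  moreover have "left_points a 1 < 4" using a by (simp add: left_points_def)
  ultimately have "\<exists>t. t \<in> D \<and> (\<forall>x. 4 \<le> x \<and> x \<le> 24 \<longrightarrow> t x = bump 4 8 x)"
    using approx[OF f_K(2), of 4 24] by auto
  from someI_ex[OF this] show "t_elt \<in> D" "4 \<le> x \<Longrightarrow> x \<le> 24 \<Longrightarrow> t_elt x = bump 4 8 x"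
    unfolding t_elt_def by auto
qed

end

text \<open>Although \<phi> is abstract, it is controlled on [l, r]: if every generator has a lift
  \<open>A\<close> such that \<open>A\<close> and \<open>\<phi> A\<close> both restrict to it, then
  so has every word, because [l, r] is invariant. With the marked elements as lifts, this carries
  points of the orbit of 8 from one group to the other.\<close>

lemma hom_locally_generated:
  assumes D: "subgroup D Homeo_plus" "subgroup D' Homeo_plus"
    and \<phi>: "\<phi> \<in> hom (Homeo_plus\<lparr>carrier := D\<rparr>) (Homeo_plus\<lparr>carrier := D'\<rparr>)"
    and S: "S \<subseteq> homeo" and fix_ends: "\<And>s. s \<in> S \<Longrightarrow> s l = l \<and> s r = r"
    and gen: "\<And>s. s \<in> S \<Longrightarrow> \<exists>A\<in>D. \<forall>x\<in>{l..r}. A x = s x \<and> \<phi> A x = s x"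
    and g: "g \<in> generate Homeo_plus S"
  shows "\<exists>A\<in>D. \<forall>x\<in>{l..r}. A x = g x \<and> \<phi> A x = g x"
proof -
  have homeo: "A \<in> homeo" if "A \<in> D \<or> A \<in> D'" for A
    using that subgroup.subset D by blast
  have \<phi>D: "\<phi> A \<in> D'" if "A \<in> D" for A
    using \<phi> that by (auto simp: hom_def)
  have \<phi>_comp: "\<phi> (A \<circ> B) = \<phi> A \<circ> \<phi> B" if "A \<in> D" "B \<in> D" for A B
    using \<phi> that by (auto simp: hom_def)
  interpret \<phi>: group_hom "Homeo_plus\<lparr>carrier := D\<rparr>" "Homeo_plus\<lparr>carrier := D'\<rparr>" \<phi>
    using HP.subgroup_imp_group D \<phi> by (simp add: group_hom_def group_hom_axioms_def)
  have \<phi>_inv: "\<phi> (hinv A) = hinv (\<phi> A)" if "A \<in> D" for A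
    using \<phi>.hom_inv[of A] that \<phi>D[OF that] HP.m_inv_consistent D by simp
  have stay: "h x \<in> {l..r}" if "h \<in> generate Homeo_plus S" "x \<in> {l..r}" for h x
  proof -
    have "h l = l" "h r = r" using generate_fix[OF S _ that(1)] fix_ends by auto
    then show ?thesis
      using that(2) homeo_le_iff[OF generate_closed_Homeo(4)[OF S that(1)]] by (metis atLeastAtMost_iff)
  qed
  show ?thesis
    using g S
  proof (induction rule: generate_Homeo_induct)
    case one
    have "\<phi> id = id" using \<phi>.hom_one by simp
    moreover have "id \<in> D" using subgroup.one_closed[OF D(1)] by simp
    ultimately show ?case by metis
  next
    case (gen s)
    then show ?case using assms(6) by blast
  next
    case (inv s)
    then obtain A where A: "A \<in> D" "\<forall>x\<in>{l..r}. A x = s x \<and> \<phi> A x = s x" using gen by blast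
    have "hinv A x = hinv s x \<and> \<phi> (hinv A) x = hinv s x" if "x \<in> {l..r}" for x
    proof -
      have "hinv s x \<in> {l..r}" using stay[OF generate.inv[OF inv(1)] that] .
      then have "A (hinv s x) = x" "\<phi> A (hinv s x) = x" using A inv(2) by auto
      then show ?thesis using A(1) \<phi>D homeo by (simp add: \<phi>_inv hinv_eq_iff)
    qed
    then show ?case using subgroup.m_inv_closed[OF D(1) A(1)] by blast
  next
    case (mult f h)
    then obtain A B where AB: "A \<in> D" "\<forall>x\<in>{l..r}. A x = f x \<and> \<phi> A x = f x"
      "B \<in> D" "\<forall>x\<in>{l..r}. B x = h x \<and> \<phi> B x = h x" by blast
    have "(A \<circ> B) x = (f \<circ> h) x \<and> \<phi> (A \<circ> B) x = (f \<circ> h) x" if "x \<in> {l..r}" for x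
      unfolding \<phi>_comp[OF AB(1,3)] using AB(2,4) that stay[OF mult.hyps(2) that] by simp
    moreover have "A \<circ> B \<in> D" using subgroup.m_closed[OF D(1) AB(1,3)] by simp
    ultimately show ?case by blast
  qed
qed

text \<open>
  \<open>x_elt a\<close> fixes everything to the right of \<open>r = bump 4 8 (12 - 2 a)\<close> and nothing just before \<open>r\<close>;
  conjugates of \<open>z_elt\<close> have their support bounded by \<open>w 8\<close> from the left. So commutation of these
  elements compares \<open>r\<close> with \<open>w 8\<close>.
\<close>

lemma marked_iso_le:
  assumes "dyadic_chain n a" "dyadic_chain n a'"
    and \<phi>: "\<phi> \<in> hom (Homeo_plus\<lparr>carrier := contracting_group.D (bump_chain.gens (left_points a) n)\<rparr>)
                 (Homeo_plus\<lparr>carrier := contracting_group.D (bump_chain.gens (left_points a') n)\<rparr>)"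
    and marked: "\<phi> (x_elt a) = x_elt a'" "\<phi> z_elt = z_elt"
      "\<phi> (dyadic_chain.t_elt n a) = dyadic_chain.t_elt n a'"
  shows "a \<le> a'"
proof (rule ccontr)
  interpret I: dyadic_chain n a by fact
  interpret J: dyadic_chain n a' by fact
  let ?r = "bump 4 8 (12 - 2 * a)" and ?r' = "bump 4 8 (12 - 2 * a')"
  assume "\<not> a \<le> a'"
  then have less: "12 - 2 * a < 12 - 2 * a'" "4 < 12 - 2 * a" "12 - 2 * a' < 8"
    using I.a J.a by auto
  have "bump 4 8 16 = 16" by (simp add: bump_simps)
  then have r: "?r < ?r'" "12 - 2 * a' < ?r'" "?r' \<le> 16"
    using less homeo_less_iff[of "bump 4 8" "12 - 2 * a'" 16] by (auto simp: homeo_less_iff bump_gt_iff)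
  moreover have "4 \<le> max ?r (12 - 2 * a')" using less by (simp add: le_max_iff_disj)
  \<comment> \<open>The lower bound includes 12 - 2 a' because \<open>x_less\<close> describes
    \<open>x_elt a'\<close> only from there on.\<close>
  ultimately obtain g where g: "g \<in> generate Homeo_plus {bump 4 8, z_elt}"
    "max ?r (12 - 2 * a') < g 8" "g 8 < ?r'"
    using dense_orbit_z[of "max ?r (12 - 2 * a')" ?r'] by auto
  have "\<exists>A\<in>I.D. \<forall>x\<in>{4..24}. A x = g x \<and> \<phi> A x = g x"
  proof (rule hom_locally_generated[OF I.subgroup_D J.subgroup_D \<phi> _ _ _ g(1)])
    fix s assume "s \<in> {bump 4 8, z_elt}"
    then consider "s = bump 4 8" | "s = z_elt" by auto
    note s = this
    show "s 4 = 4 \<and> s 24 = 24"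
      using s by cases (auto simp: bump_simps z_left z_right)
    show "\<exists>A\<in>I.D. \<forall>x\<in>{4..24}. A x = s x \<and> \<phi> A x = s x"
      using s
    proof cases
      case 1
      then show ?thesis using I.t_elt J.t_elt marked(3) by (intro bexI[of _ I.t_elt]) auto
    next
      case 2
      then show ?thesis using I.z_D marked(2) by auto
    qed
  qed simp
  then obtain A where A: "A \<in> I.D" "A 8 = g 8" "\<phi> A 8 = g 8" by fastforce
  define B where "B = \<phi> A"
  have BD: "B \<in> J.D" using \<phi> A(1) by (auto simp: hom_def B_def)
  note homeo = I.D_homeo[OF A(1)] J.D_homeo[OF BD] I.D_homeo[OF I.x_D] J.D_homeo[OF J.x_D]
  \<comment> \<open>\<open>u\<close> is trivial up to \<open>g 8\<close>, which lies beyond the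
    support of \<open>x_elt a\<close>, so the two commute. Its image \<open>v\<close> is trivial up
    to the same point, which \<open>x_elt a'\<close> still moves.\<close>
  define u where "u = A \<circ> z_elt \<circ> hinv A"
  define v where "v = B \<circ> z_elt \<circ> hinv B"
  have uD: "u \<in> I.D" unfolding u_def using A(1) I.z_D I.D_comp I.D_inv by simp
  interpret \<phi>: group_hom "Homeo_plus\<lparr>carrier := I.D\<rparr>" "Homeo_plus\<lparr>carrier := J.D\<rparr>" \<phi>
    using HP.subgroup_imp_group I.subgroup_D J.subgroup_D \<phi> by (simp add: group_hom_def group_hom_axioms_def)
  have \<phi>_comp: "\<phi> (f \<circ> h) = \<phi> f \<circ> \<phi> h" if "f \<in> I.D" "h \<in> I.D" for f h
    using \<phi>.hom_mult[of f h] that by simp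
  have "\<phi> (hinv A) = hinv B"
    using \<phi>.hom_inv[of A] A(1) BD HP.m_inv_consistent I.subgroup_D J.subgroup_D by (simp add: B_def)
  then have \<phi>u: "\<phi> u = v"
    unfolding u_def v_def using A(1) I.z_D I.D_comp I.D_inv by (simp add: \<phi>_comp marked B_def)
  have "x_elt a \<circ> u = u \<circ> x_elt a"
  proof (rule homeo_commute_disjoint)
    fix y
    show "x_elt a y = y \<or> u y = y"
    proof (cases "?r \<le> y")
      case True
      then show ?thesis using x_right I.a by simp
    next
      case False
      then have "hinv A y \<le> 8" using g(2) A(2) homeo(1) by (simp add: hinv_le_iff)
      then show ?thesis using homeo(1) z_left by (simp add: u_def)
    qed
  qed (use homeo I.D_homeo[OF uD] in auto)
  then have "\<phi> (x_elt a \<circ> u) = \<phi> (u \<circ> x_elt a)" by simp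
  then have comm: "x_elt a' \<circ> v = v \<circ> x_elt a'"
    using I.x_D uD by (simp add: \<phi>_comp \<phi>u marked)
  define p where "p = g 8"
  have "x_elt a' p < p" using x_less[of a' p] J.a g(2,3) by (simp add: p_def)
  then have "p < hinv (x_elt a') p" using homeo(4) by (simp add: less_hinv_iff)
  moreover have "p < B 16" using homeo(2) A(3) homeo_less_iff[of B 8 16] by (simp add: p_def B_def)
  \<comment> \<open>\<open>q\<close> is so close to \<open>p\<close> that \<open>x_elt a'\<close>
    takes it below \<open>p\<close>, where \<open>v\<close> is trivial, and that \<open>v\<close>
    itself moves it.\<close>
  ultimately obtain q where q: "p < q" "q < hinv (x_elt a') p" "q < B 16"
    using dense[of p "min (hinv (x_elt a') p) (B 16)"] by auto
  have "8 < hinv B q" "hinv B q < 16"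
    using q A(3) homeo(2) by (simp_all add: less_hinv_iff hinv_less_iff p_def B_def)
  then have "z_elt (hinv B q) \<noteq> hinv B q" using z_less[of "hinv B q"] by simp
  then have "v q \<noteq> q"
    using homeo(2) homeo_conj_fix_iff[of z_elt B q] by (simp add: v_def)
  have "x_elt a' q < p" using q(2) homeo(4) by (simp add: less_hinv_iff)
  then have "hinv B (x_elt a' q) \<le> 8" using homeo(2) A(3) by (simp add: hinv_le_iff p_def B_def)
  then have "v (x_elt a' q) = x_elt a' q" using homeo(2) z_left by (simp add: v_def)
  then have "x_elt a' (v q) = x_elt a' q" using comm by (metis comp_apply)
  then show False using \<open>v q \<noteq> q\<close> homeo(4) by (simp add: homeo_eq_iff)
qed

section \<open>Counting isomorphism classes and presentations\<close>

definition chain_family :: "nat \<Rightarrow> real \<Rightarrow> (real \<Rightarrow> real) monoid" where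
  "chain_family n a = subgroup_generated Homeo_plus (bump_chain.gens (left_points a) n)"

lemma commutator_chain_family:
  assumes "dyadic_chain n a"
  shows "commutator_subgroup (chain_family n a)
    = Homeo_plus\<lparr>carrier := contracting_group.D (bump_chain.gens (left_points a) n)\<rparr>"
proof -
  interpret dyadic_chain n a by fact
  show ?thesis unfolding chain_family_def by (rule commutator_subgroup_eq)
qed

lemma group_commutator_chain_family:
  assumes "dyadic_chain n a"
  shows "group (commutator_subgroup (chain_family n a))"
proof -
  interpret dyadic_chain n a by fact
  show ?thesis unfolding chain_family_def commutator_subgroup_eq
    using subgroup_D by (rule HP.subgroup_imp_group)
qed

text \<open>One group of the class is fixed. An isomorphism onto it sends the three marks belonging
  to \<open>a\<close> to a triple in a fixed countable set. If two parameters yield the same triple,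
  one isomorphism followed by the inverse of the other preserves the marks, and
  \<open>marked_iso_le\<close>, used in both directions, identifies the parameters.\<close>

lemma countable_iso_class:
  assumes "3 \<le> n"
  shows "countable {a \<in> {2<..<4}.
    commutator_subgroup (chain_family n a) \<cong> commutator_subgroup (chain_family n b)}" (is "countable ?E")
proof (cases "?E = {}")
  case False
  then obtain a0 where a0: "a0 \<in> ?E" by blast
  let ?CG = "\<lambda>a. commutator_subgroup (chain_family n a)"
  let ?D = "\<lambda>a. contracting_group.D (bump_chain.gens (left_points a) n)"
  have chain: "dyadic_chain n a" if "a \<in> ?E" for a
    using that assms by unfold_locales auto
  have CG: "?CG a = Homeo_plus\<lparr>carrier := ?D a\<rparr>" if "a \<in> ?E" for a
    using commutator_chain_family[OF chain[OF that]] .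
  have "?CG a \<cong> ?CG a0" if "a \<in> ?E" for a
  proof -
    have "?CG b \<cong> ?CG a0"
      using a0 group.iso_sym[OF group_commutator_chain_family[OF chain[OF a0]]] by blast
    then show ?thesis using that iso_trans by blast
  qed
  then have ex: "\<exists>h. h \<in> iso (?CG a) (?CG a0)" if "a \<in> ?E" for a
    using that by (auto simp: is_iso_def)
  define \<psi> where "\<psi> a = (SOME h. h \<in> iso (?CG a) (?CG a0))" for a
  have \<psi>: "\<psi> a \<in> iso (?CG a) (?CG a0)" if "a \<in> ?E" for a
    unfolding \<psi>_def by (rule someI_ex[OF ex[OF that]])
  define F where "F a = (\<psi> a (x_elt a), \<psi> a z_elt, \<psi> a (dyadic_chain.t_elt n a))" for a
  have marks: "x_elt a \<in> ?D a" "z_elt \<in> ?D a" "dyadic_chain.t_elt n a \<in> ?D a" if "a \<in> ?E" for a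
  proof -
    interpret dyadic_chain n a using chain[OF that] .
    show "x_elt a \<in> ?D a" "z_elt \<in> ?D a" "t_elt \<in> ?D a" by (rule x_D z_D t_elt)+
  qed
  have le: "a \<le> a'" if E: "a \<in> ?E" "a' \<in> ?E" and "F a = F a'" for a a'
  proof -
    have grp: "group (?CG a')"
      using group_commutator_chain_family[OF chain[OF E(2)]] .
    define \<phi> where "\<phi> = inv_into (carrier (?CG a')) (\<psi> a') \<circ> \<psi> a"
    have "inv_into (carrier (?CG a')) (\<psi> a') \<in> iso (?CG a0) (?CG a')"
      using group.iso_set_sym[OF grp \<psi>[OF E(2)]] .
    then have "\<phi> \<in> iso (?CG a) (?CG a')"
      unfolding \<phi>_def by (rule iso_set_trans[OF \<psi>[OF E(1)]])
    then have "\<phi> \<in> hom (?CG a) (?CG a')" by (simp add: iso_def)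
    moreover have "inv_into (carrier (?CG a')) (\<psi> a') (\<psi> a' y) = y" if "y \<in> ?D a'" for y
      using \<psi>[OF E(2)] that by (intro inv_into_f_f) (auto simp: iso_def bij_betw_def CG[OF E(2)])
    then have "\<phi> (x_elt a) = x_elt a'" "\<phi> z_elt = z_elt"
      "\<phi> (dyadic_chain.t_elt n a) = dyadic_chain.t_elt n a'"
      using \<open>F a = F a'\<close> marks[OF E(2)] by (simp_all add: \<phi>_def F_def)
    ultimately show ?thesis
      using marked_iso_le[OF chain[OF E(1)] chain[OF E(2)]] unfolding CG[OF E(1)] CG[OF E(2)] by blast
  qed
  have inj: "inj_on F ?E"
  proof (rule inj_onI)
    fix a a' assume E: "a \<in> ?E" "a' \<in> ?E" and F: "F a = F a'"
    show "a = a'" using le[OF E F] le[OF E(2,1) F[symmetric]] by simp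
  qed
  have img: "F ` ?E \<subseteq> ?D a0 \<times> ?D a0 \<times> ?D a0"
  proof
    fix w assume "w \<in> F ` ?E"
    then obtain a where a: "a \<in> ?E" "w = F a" by blast
    have "\<psi> a y \<in> ?D a0" if "y \<in> ?D a" for y
      using \<psi>[OF a(1)] that unfolding CG[OF a(1)] CG[OF a0] by (auto simp: iso_def hom_def)
    then show "w \<in> ?D a0 \<times> ?D a0 \<times> ?D a0" using marks[OF a(1)] by (simp add: a(2) F_def)
  qed
  have D0: "countable (?D a0)"
  proof -
    interpret dyadic_chain n a0 using chain[OF a0] .
    have "countable K"
      unfolding K_def using gens_homeo by (intro HP.countable_generate) (auto simp: gens_def)
    then show ?thesis using D_subset_K countable_subset by blast
  qed
  have "countable (F ` ?E)"
    using img countable_SIGMA[OF D0 countable_SIGMA[OF D0 D0]] by (rule countable_subset)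
  then show ?thesis using inj by (rule countable_image_inj_on)
next
  case True
  then show ?thesis by (simp only: countable_empty)
qed

lemma group_chain_family: "group (chain_family n a)"
  by (simp add: chain_family_def)

text \<open>Parameters whose groups share a presentation have isomorphic commutator subgroups, so
  \<open>countable_iso_class\<close> bounds the contribution of each finite presentation.\<close>

lemma countable_finitely_presentable:
  assumes "3 \<le> n"
  shows "countable {a \<in> {2<..<4}. finitely_presentable (chain_family n a)}"
proof -
  define Q :: "(nat set \<times> nat word set) set" where "Q = Collect finite \<times> Collect finite"
  have "countable Q"
    unfolding Q_def by (intro countable_SIGMA countable_Collect_finite)
  let ?E = "\<lambda>(S, R). {a \<in> {2<..<4}. chain_family n a \<cong> presented_group S R}"
  have "countable (?E q)" for q
  proof (cases "?E q = {}")
    case False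
    obtain S R where q: "q = (S, R)" by force
    from False obtain b where b: "b \<in> ?E q" by blast
    have "?E q \<subseteq> {a \<in> {2<..<4}.
        commutator_subgroup (chain_family n a) \<cong> commutator_subgroup (chain_family n b)}"
    proof
      fix a assume a: "a \<in> ?E q"
      have "presented_group S R \<cong> chain_family n b"
        using b group.iso_sym[OF group_chain_family] by (auto simp: q)
      then have "chain_family n a \<cong> chain_family n b" using a iso_trans by (auto simp: q)
      then show "a \<in> {a \<in> {2<..<4}.
          commutator_subgroup (chain_family n a) \<cong> commutator_subgroup (chain_family n b)}"
        using a commutator_subgroup_iso[OF group_chain_family group_chain_family] by (auto simp: q)
    qed
    then show ?thesis using countable_iso_class[OF assms] by (rule countable_subset)
  next
    case True
    then show ?thesis by (simp only: countable_empty)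
  qed
  then have "countable (\<Union>q\<in>Q. ?E q)" using \<open>countable Q\<close> by blast
  moreover have "{a \<in> {2<..<4}. finitely_presentable (chain_family n a)} \<subseteq> (\<Union>q\<in>Q. ?E q)"
    by (fastforce simp: finitely_presentable_def Q_def)
  ultimately show ?thesis by (rule countable_subset[rotated])
qed

theorem theorem1p7:
  fixes n :: nat
  assumes "n \<ge> 3"
  shows "\<exists>\<G> :: (real \<Rightarrow> real) monoid set.
           uncountable \<G> \<and>
           (\<forall>G\<in>\<G>. chain_group n G \<and> infinitely_presented G \<and>
                   is_simple (commutator_subgroup G)) \<and>
           (\<forall>G\<in>\<G>. \<forall>H\<in>\<G>. G \<noteq> H \<longrightarrow>
              \<not> commutator_subgroup G \<cong> commutator_subgroup H)"
proof -
  let ?CG = "\<lambda>a. commutator_subgroup (chain_family n a)"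
  define P where "P = {a \<in> {2<..<4::real}. infinitely_presented (chain_family n a)}"
  define cls where "cls a = {b \<in> P. ?CG b \<cong> ?CG a}" for a
  have chain: "dyadic_chain n a" if "a \<in> P" for a
    using that assms by unfold_locales (auto simp: P_def)
  have "uncountable P"
  proof
    assume "countable P"
    then have "countable (P \<union> {a \<in> {2<..<4}. finitely_presentable (chain_family n a)})"
      using countable_finitely_presentable[OF assms] by simp
    moreover have "P \<union> {a \<in> {2<..<4}. finitely_presentable (chain_family n a)} = {2<..<4}"
      by (auto simp: P_def infinitely_presented_def)
    ultimately have "countable {2<..<4::real}" by (simp only:)
    then show False using uncountable_open_interval[of 2 "4::real"] by simp
  qed
  have sym: "?CG b \<cong> ?CG a" if "?CG a \<cong> ?CG b" "a \<in> P" for a b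
    using group.iso_sym[OF group_commutator_chain_family[OF chain[OF that(2)]] that(1)] .
  \<comment> \<open>The choice depends only on the set \<open>cls a\<close>, so parameters with
    isomorphic commutator subgroups get the same representative.\<close>
  define rep where "rep a = (SOME b. b \<in> cls a)" for a
  have rep: "rep a \<in> P" "?CG (rep a) \<cong> ?CG a" if "a \<in> P" for a
  proof -
    have "a \<in> cls a" using that by (simp add: cls_def)
    then have "rep a \<in> cls a" unfolding rep_def by (rule someI)
    then show "rep a \<in> P" "?CG (rep a) \<cong> ?CG a" by (auto simp: cls_def)
  qed
  have rep_eq: "rep a = rep b" if "a \<in> P" "b \<in> P" "?CG a \<cong> ?CG b" for a b
  proof -
    have "cls a = cls b"
      using that sym[OF that(3,1)] by (auto simp: cls_def intro: iso_trans)
    then show ?thesis by (simp add: rep_def)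
  qed
  define M where "M = rep ` P"
  have MP: "M \<subseteq> P" using rep by (auto simp: M_def)
  have distinct: "a = b" if M: "a \<in> M" "b \<in> M" "?CG a \<cong> ?CG b" for a b
  proof -
    obtain a' b' where ab: "a' \<in> P" "b' \<in> P" "a = rep a'" "b = rep b'"
      using M(1,2) unfolding M_def by blast
    have "?CG a' \<cong> ?CG a" "?CG b \<cong> ?CG b'" using rep ab sym by auto
    then have "?CG a' \<cong> ?CG b'" using M(3) iso_trans by blast
    then have "rep a' = rep b'" by (rule rep_eq[OF ab(1,2)])
    then show ?thesis by (simp only: ab(3,4))
  qed
  have "uncountable M"
  proof
    assume "countable M"
    \<comment> \<open>\<open>P\<close> is covered by one class for each representative, and every
      class is countable.\<close>
    have "P \<subseteq> (\<Union>b\<in>M. {a \<in> {2<..<4}. ?CG a \<cong> ?CG b})"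
    proof
      fix a assume a: "a \<in> P"
      then have "?CG a \<cong> ?CG (rep a)" "rep a \<in> M" "a \<in> {2<..<4}"
        using sym[OF rep(2,1)] unfolding M_def by (auto simp: P_def)
      then show "a \<in> (\<Union>b\<in>M. {a \<in> {2<..<4}. ?CG a \<cong> ?CG b})" by blast
    qed
    moreover have "countable (\<Union>b\<in>M. {a \<in> {2<..<4}. ?CG a \<cong> ?CG b})"
      using \<open>countable M\<close> by (intro countable_UN countable_iso_class assms)
    ultimately have "countable P" by (rule countable_subset)
    with \<open>uncountable P\<close> show False by contradiction
  qed
  \<comment> \<open>Equal groups have equal commutator subgroups, so \<open>distinct\<close>
    separates the groups as well and the family stays uncountable as a set of groups.\<close>
  moreover have "inj_on (chain_family n) M"
  proof (rule inj_onI)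
    fix a b assume M: "a \<in> M" "b \<in> M" and eq: "chain_family n a = chain_family n b"
    show "a = b" by (rule distinct[OF M]) (simp add: eq)
  qed
  ultimately have "uncountable (chain_family n ` M)"
    using countable_image_inj_on[of "chain_family n" M] by metis
  moreover have "chain_group n (chain_family n a) \<and> infinitely_presented (chain_family n a) \<and>
      is_simple (?CG a)" if "a \<in> M" for a
  proof -
    interpret dyadic_chain n a using chain MP that by blast
    show ?thesis
      using MP that chain_group simple_commutator_subgroup by (auto simp: P_def chain_family_def)
  qed
  moreover have "\<not> ?CG a \<cong> ?CG b" if "a \<in> M" "b \<in> M" "chain_family n a \<noteq> chain_family n b" for a b
    using distinct that by blast
  ultimately show ?thesis
    by (intro exI[of _ "chain_family n ` M"]) auto
qed

end
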